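(* Let $S$ be a ssyt with entries in $[n]$, with $p$ rows and $c$ nonempty columns, and let $\pi^1\le\dots\le\pi^c$ be its minimal chain. Let $\hat S_p$ be the coloured filled configuration obtained from $S$ as described in the context. Then for each $i$, $1\le i\le c$, and each $k$, $1\le k\le p$, $\pi^i_k$ equals the value of the entry of colour $k$ in column $i$ of $\hat S_p$; and $\pi^i_{p+1},\dots,\pi^i_n$ are the remaining elements of $[n]$ in increasing order.
   Context: Bruhat order on $\mathfrak S_n$: for $t$-element subsets $E,F\subseteq[n]$ write $E\le F$ if the $k$-th smallest element of $E$ is at most the $k$-th smallest element of $F$ for all $k$; then $u\le v$ in Bruhat order iff $\{u_1,\dots,u_i\}\le\{v_1,\dots,v_i\}$ for all $i$ (one-line notation). Minimal chain of $S$: let $k_i$ be the number of boxes in column $i$ of $S$. $\pi^1$ is the permutation whose first $k_1=p$ entries are the entries of column 1 of $S$ top to bottom and whose remaining entries are in increasing order. For $i>1$, $\pi^i$ is the unique minimal element in Bruhat order among permutations whose first $k_i$ entries are those of column $i$ of $S$ top to bottom and which are $\ge\pi^{i-1}$ (such an element exists and is unique). Push-down procedure producing configurations $S_1,\dots,S_p$: a configuration is an arrangement of contents in boxes (positions) of a grid. $S_1:=S$. For $i=2,\dots,p$, starting from $S_{i-1}$, let $\mathbf e'$ be the rightmost entry in row $i$ and repeat: in the row immediately above that of $\mathbf e'$, if some entry has value $\ge$ that of $\mathbf e'$, let $\mathbf c$ be the leftmost such, shift the contents of all positions of that row from the column of $\mathbf c$ rightwards one row down, and redesignate $\mathbf e'$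 to be the entry immediately left of the former position of $\mathbf c$; otherwise stop; the result is $S_i$. Coloured filled configurations: $\hat S_1$ is $S$ with every entry of row $r$ given colour $r$. For $i\ge2$, $\hat S_i$ is obtained from $\hat S_{i-1}$ by moving the contents (values with their colours) of positions exactly as positions move in passing from $S_{i-1}$ to $S_i$, and then, in each of rows $1,\dots,i$, going from left to right, filling every empty box in columns $1,\dots,c$ with the value in the box immediately to its left, these new entries receiving colour $i$. Colours are never changed once assigned. *)

theory Defs
  imports "HOL-Combinatorics.Permutations"
begin

(* Rows, columns, colours and the arguments of permutations are all counted from 1, and
   [n] is {1..n}; a permutation in one-line notation w_1 ... w_n is a function w with
   "w permutes {1..n}".  Row numbers increase downwards. *)

subsection \<open>Semistandard tableaux\<close>

(* A tableau is the list of its rows, from top to bottom, each row being left-justified. *)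
type_synonym tableau = "nat list list"

definition num_rows :: "tableau \<Rightarrow> nat" where
  "num_rows S = length S"

definition num_cols :: "tableau \<Rightarrow> nat" where
  "num_cols S = (case S of [] \<Rightarrow> 0 | row # _ \<Rightarrow> length row)"

definition tab_column :: "tableau \<Rightarrow> nat \<Rightarrow> nat list" where
  "tab_column S i = map (\<lambda>row. row ! (i - 1)) (filter (\<lambda>row. i \<le> length row) S)"

definition ssyt :: "nat \<Rightarrow> tableau \<Rightarrow> bool" where
  "ssyt n S \<longleftrightarrow>
     sorted_wrt (\<ge>) (map length S) \<and>
     (\<forall>row \<in> set S. row \<noteq> [] \<and> sorted row \<and> set row \<subseteq> {1..n}) \<and>
     (\<forall>i \<in> {1..num_cols S}. sorted_wrt (<) (tab_column S i))"

subsection \<open>Bruhat order and the minimal chain\<close>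

definition subset_le :: "nat set \<Rightarrow> nat set \<Rightarrow> bool" where
  "subset_le E F \<longleftrightarrow> list_all2 (\<le>) (sorted_list_of_set E) (sorted_list_of_set F)"

definition bruhat_le :: "nat \<Rightarrow> (nat \<Rightarrow> nat) \<Rightarrow> (nat \<Rightarrow> nat) \<Rightarrow> bool" where
  "bruhat_le n u v \<longleftrightarrow> (\<forall>i \<in> {1..n}. subset_le (u ` {1..i}) (v ` {1..i}))"

definition bruhat_minimal :: "nat \<Rightarrow> (nat \<Rightarrow> nat) set \<Rightarrow> (nat \<Rightarrow> nat) \<Rightarrow> bool" where
  "bruhat_minimal n A w \<longleftrightarrow> w \<in> A \<and> (\<forall>v \<in> A. bruhat_le n v w \<longrightarrow> v = w)"

definition perms_with_prefix :: "nat \<Rightarrow> nat list \<Rightarrow> (nat \<Rightarrow> nat) set" where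
  "perms_with_prefix n xs = {w. w permutes {1..n} \<and> map w [1..<length xs + 1] = xs}"

definition increasing_completion :: "nat \<Rightarrow> nat list \<Rightarrow> nat \<Rightarrow> nat" where
  "increasing_completion n xs k =
     (if k \<in> {1..n} then (xs @ sorted_list_of_set ({1..n} - set xs)) ! (k - 1) else k)"

(* The index 0 is not used: the chain starts at 1. *)
fun min_chain :: "nat \<Rightarrow> tableau \<Rightarrow> nat \<Rightarrow> nat \<Rightarrow> nat" where
  "min_chain n S 0 = id"
| "min_chain n S (Suc 0) = increasing_completion n (tab_column S 1)"
| "min_chain n S (Suc (Suc i)) =
     (THE w. bruhat_minimal n
        {v \<in> perms_with_prefix n (tab_column S (Suc (Suc i))).
           bruhat_le n (min_chain n S (Suc i)) v} w)"

subsection \<open>Configurations and the push-down procedure\<close>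

(* T r j is the content of the box in row r and column j; None means that it is empty. *)
type_synonym 'a config = "nat \<Rightarrow> nat \<Rightarrow> 'a option"

definition tableau_config :: "tableau \<Rightarrow> nat config" where
  "tableau_config S r j =
     (if r \<in> {1..num_rows S} \<and> j \<in> {1..length (S ! (r - 1))}
      then Some (S ! (r - 1) ! (j - 1)) else None)"

(* All positions of row r from column m rightwards move one row down. *)
definition shift_down :: "nat \<times> nat \<Rightarrow> 'a config \<Rightarrow> 'a config" where
  "shift_down = (\<lambda>(r, m) T r' j.
     if j < m then T r' j
     else if r' = r then None
     else if r' = Suc r then T r j
     else T r' j)"

(* pushes T r j is the list of the shifts (row, first shifted column) performed in turn from
   the configuration T when the entry e' is in row r, column j.  After a shift of row r from
   column m on, the entry immediately left of column m is the last one that row r retains;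
   empty boxes may separate it from column m. *)
fun pushes :: "nat config \<Rightarrow> nat \<Rightarrow> nat \<Rightarrow> (nat \<times> nat) list" where
  "pushes T 0 j = []"
| "pushes T (Suc r) j =
     (let C = {m. \<exists>y. T r m = Some y \<and> the (T (Suc r) j) \<le> y} in
      if C = {} then []
      else let m = (LEAST m. m \<in> C);
               T' = shift_down (r, m) T;
               j' = Max {l. l < m \<and> T' r l \<noteq> None}
           in (r, m) # pushes T' r j')"

definition row_pushes :: "nat config \<Rightarrow> nat \<Rightarrow> (nat \<times> nat) list" where
  "row_pushes T i = pushes T i (Max {j. T i j \<noteq> None})"

(* pushed S i is S_i and coloured S i is its coloured filled version; both start at i = 1. *)
fun pushed :: "tableau \<Rightarrow> nat \<Rightarrow> nat config" where
  "pushed S 0 = tableau_config S"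
| "pushed S (Suc 0) = tableau_config S"
| "pushed S (Suc (Suc i)) =
     fold shift_down (row_pushes (pushed S (Suc i)) (Suc (Suc i))) (pushed S (Suc i))"

subsection \<open>Coloured filled configurations\<close>

(* The content of a coloured box is the pair (value, colour). *)
definition row_coloured :: "nat config \<Rightarrow> (nat \<times> nat) config" where
  "row_coloured T r j = map_option (\<lambda>v. (v, r)) (T r j)"

primrec fill_row :: "nat \<Rightarrow> (nat \<Rightarrow> (nat \<times> nat) option) \<Rightarrow> nat \<Rightarrow> (nat \<times> nat) option" where
  "fill_row k R 0 = R 0"
| "fill_row k R (Suc j) =
     (case R (Suc j) of
        Some e \<Rightarrow> Some e
      | None \<Rightarrow> map_option (\<lambda>(v, _). (v, k)) (fill_row k R j))"

definition fill :: "nat \<Rightarrow> nat \<Rightarrow> (nat \<times> nat) config \<Rightarrow> (nat \<times> nat) config" where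
  "fill c i T r j = (if r \<in> {1..i} \<and> j \<in> {1..c} then fill_row i (T r) j else T r j)"

fun coloured :: "tableau \<Rightarrow> nat \<Rightarrow> (nat \<times> nat) config" where
  "coloured S 0 = row_coloured (tableau_config S)"
| "coloured S (Suc 0) = row_coloured (tableau_config S)"
| "coloured S (Suc (Suc i)) =
     fill (num_cols S) (Suc (Suc i))
       (fold shift_down (row_pushes (pushed S (Suc i)) (Suc (Suc i))) (coloured S (Suc i)))"

end

theory Submission
  imports Defs
begin

text \<open>Bruhat order compares, for every \<open>k\<close> and \<open>x\<close>, the number of the first \<open>k\<close> entries that are at most \<open>x\<close>.
  With a prescribed prefix, the least \<open>w \<ge> u\<close> is therefore found greedily: \<open>w\<^sub>k\<close> is the successor of the last
  \<open>x < u\<^sub>k\<close> at which the counts of \<open>u\<^sub>1, \<dots>, u\<^sub>k\<^sub>-\<^sub>1\<close> and \<open>w\<^sub>1, \<dots>, w\<^sub>k\<^sub>-\<^sub>1\<close> agree. On the other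
  side, the filled configurations are semistandard rectangles; step \<open>k\<close> cuts the rows at weakly increasing columns
  (from the bottom row up), pushes down what lies beyond the cuts, and puts exactly one new entry into
  each column to the right of row \<open>k\<close> of \<open>S\<close>. When one passes from a column to the next, this new entry
  changes precisely by the greedy rule.\<close>

subsection \<open>Bruhat order and the greedy choice\<close>

text \<open>The chain is given by a definite description of a Bruhat-minimal element, so existence
  and uniqueness are both needed. The greedy permutation is not shown to be a minimum directly: an
  exchange undercuts every competitor, and finiteness supplies some minimal element, which must then
  be the greedy one. The two sides meet because, besides \<open>u k\<close>, the greedy choice of
  position \<open>k\<close> depends on the earlier entries only through counts, hence only on sets.
  Such a set is a column of the filled array before step \<open>k\<close>, where it is sorted, so
  counts turn into row numbers and it does not matter in which row a colour sits. The obstacle is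
  that pushes are computed on the configuration with gaps, while the order arguments need the filled
  array. A gap repeats the value on its left, so it is never the first box of its row to reach a
  threshold, and both configurations yield the same cut.\<close>

definition cnt :: "(nat \<Rightarrow> nat) \<Rightarrow> nat \<Rightarrow> nat \<Rightarrow> nat" where
  "cnt w k x = card {l \<in> {1..k}. w l \<le> x}"

lemma cnt_0 [simp]: "cnt w 0 x = 0"
  by (simp add: cnt_def)

lemma cnt_Suc [simp]: "cnt w (Suc k) x = cnt w k x + (if w (Suc k) \<le> x then 1 else 0)"
proof -
  have "{l \<in> {1..Suc k}. w l \<le> x} = (if w (Suc k) \<le> x then insert (Suc k) else id) {l \<in> {1..k}. w l \<le> x}"
    by (auto simp: le_Suc_eq)
  then show ?thesis by (simp add: cnt_def)
qed

lemma cnt_cong: "(\<And>l. l \<in> {1..k} \<Longrightarrow> u l = w l) \<Longrightarrow> cnt u k x = cnt w k x"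
  unfolding cnt_def by (metis (mono_tags, lifting) Collect_cong)

lemma cnt_image: "inj_on w {1..k} \<Longrightarrow> card (w ` {1..k} \<inter> {..x}) = cnt w k x"
proof -
  assume inj: "inj_on w {1..k}"
  have "w ` {1..k} \<inter> {..x} = w ` {l \<in> {1..k}. w l \<le> x}" by auto
  then show ?thesis unfolding cnt_def
    by (simp add: card_image[OF inj_on_subset[OF inj]] subset_iff)
qed

text \<open>In a strictly increasing list the entries up to \<open>x\<close> form an initial
  segment, so position and count determine each other. This turns comparisons of sorted lists into
  comparisons of counts.\<close>

lemma strict_sorted_card_le:
  fixes xs :: "nat list"
  assumes "sorted_wrt (<) xs" "i < length xs"
  shows "xs ! i \<le> x \<longleftrightarrow> i < card (set xs \<inter> {..x})"
proof
  assume le: "xs ! i \<le> x"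
  have "set (take (Suc i) xs) \<subseteq> set xs \<inter> {..x}"
  proof
    fix y assume "y \<in> set (take (Suc i) xs)"
    then obtain l where l: "l \<le> i" "y = xs ! l" "l < length xs"
      by (auto simp: in_set_conv_nth less_Suc_eq_le)
    then have "y \<le> xs ! i"
      using assms sorted_wrt_nth_less[OF assms(1), of l i] by (cases "l = i") auto
    then show "y \<in> set xs \<inter> {..x}" using l le by auto
  qed
  moreover have "card (set (take (Suc i) xs)) = Suc i"
    using assms by (simp add: distinct_card strict_sorted_iff)
  ultimately show "i < card (set xs \<inter> {..x})"
    by (metis Suc_le_lessD card_mono finite_Int finite_set)
next
  assume lt: "i < card (set xs \<inter> {..x})"
  show "xs ! i \<le> x"
  proof (rule ccontr)
    assume "\<not> xs ! i \<le> x"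
    have "set xs \<inter> {..x} \<subseteq> set (take i xs)"
    proof
      fix y assume "y \<in> set xs \<inter> {..x}"
      then obtain l where l: "l < length xs" "y = xs ! l" "y \<le> x"
        by (auto simp: in_set_conv_nth)
      have "l < i"
      proof (rule ccontr)
        assume "\<not> l < i"
        then have "xs ! i \<le> xs ! l"
          using l assms sorted_wrt_nth_less[OF assms(1), of i l] by (cases "l = i") auto
        then show False using l \<open>\<not> xs ! i \<le> x\<close> by simp
      qed
      then show "y \<in> set (take i xs)" using l assms(2) by (auto simp: in_set_conv_nth)
    qed
    then have "card (set xs \<inter> {..x}) \<le> card (set (take i xs))" by (simp add: card_mono)
    also have "\<dots> \<le> i" using card_length[of "take i xs"] by simp
    finally show False using lt by simp
  qed
qed

lemma subset_le_iff_card: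
  assumes "finite E" "finite F"
  shows "subset_le E F \<longleftrightarrow> card E = card F \<and> (\<forall>x. card (F \<inter> {..x}) \<le> card (E \<inter> {..x}))"
proof -
  define xs ys where "xs = sorted_list_of_set E" and "ys = sorted_list_of_set F"
  have s: "sorted_wrt (<) xs" "sorted_wrt (<) ys" "set xs = E" "set ys = F"
    "length xs = card E" "length ys = card F"
    using assms by (simp_all add: xs_def ys_def)
  note X = strict_sorted_card_le[OF s(1), unfolded s] and Y = strict_sorted_card_le[OF s(2), unfolded s]
  have "(\<forall>i < card E. xs ! i \<le> ys ! i) \<longleftrightarrow> (\<forall>x. card (F \<inter> {..x}) \<le> card (E \<inter> {..x}))"
    if eq: "card E = card F"
  proof
    assume le: "\<forall>i < card E. xs ! i \<le> ys ! i"
    show "\<forall>x. card (F \<inter> {..x}) \<le> card (E \<inter> {..x})"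
    proof (rule allI, rule ccontr)
      fix x assume "\<not> card (F \<inter> {..x}) \<le> card (E \<inter> {..x})"
      then have lt: "card (E \<inter> {..x}) < card (F \<inter> {..x})" by simp
      also have "\<dots> \<le> card F" using assms by (simp add: card_mono)
      finally have "card (E \<inter> {..x}) < card E" using eq by simp
      \<comment> \<open>At index \<open>card (E \<inter> {..x})\<close> the list \<open>xs\<close>
        has already passed \<open>x\<close> while \<open>ys\<close> has not.\<close>
      then show False using X[of "card (E \<inter> {..x})" x] Y[of "card (E \<inter> {..x})" x] le lt eq
        by (metis le_trans less_irrefl)
    qed
  next
    assume "\<forall>x. card (F \<inter> {..x}) \<le> card (E \<inter> {..x})"
    then show "\<forall>i < card E. xs ! i \<le> ys ! i"
      using X Y eq by (metis order.refl order_less_le_trans)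
  qed
  then show ?thesis
    unfolding subset_le_def list_all2_conv_all_nth using s by (auto simp: xs_def ys_def)
qed

text \<open>The inequality turns round because larger entries leave fewer entries up to
  \<open>x\<close>. Injectivity gives prefix sets of equal size, so only the counts remain.\<close>

lemma bruhat_le_iff_cnt:
  assumes "u permutes {1..n}" "v permutes {1..n}"
  shows "bruhat_le n u v \<longleftrightarrow> (\<forall>k \<in> {1..n}. \<forall>x. cnt v k x \<le> cnt u k x)"
proof -
  have "inj_on u A" "inj_on v A" for A
    using assms permutes_inj inj_on_subset by blast+
  then show ?thesis
    unfolding bruhat_le_def by (simp only: subset_le_iff_card cnt_image card_image finite_imageI finite_atLeastAtMost simp_thms)
qed

lemma cnt_determines:
  assumes "\<And>k x. k \<in> {1..n} \<Longrightarrow> cnt u k x = cnt v k x" "k \<in> {1..n}"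
  shows "u k = v k"
proof -
  obtain t where t: "k = Suc t" using assms(2) by (cases k) auto
  have "cnt u t x = cnt v t x" for x
    using assms t by (cases "t = 0") auto
  then have "u k \<le> x \<longleftrightarrow> v k \<le> x" for x
    using assms(1)[OF assms(2), of x] unfolding t by (auto split: if_splits)
  then show ?thesis by (meson order.refl order.antisym)
qed

lemma bruhat_le_antisym:
  assumes u: "u permutes {1..n}" and v: "v permutes {1..n}"
    and le: "bruhat_le n u v" "bruhat_le n v u"
  shows "u = v"
proof
  fix k
  have "cnt u l x = cnt v l x" if "l \<in> {1..n}" for l x
    using le that unfolding bruhat_le_iff_cnt[OF u v] bruhat_le_iff_cnt[OF v u]
    by (intro order.antisym) blast+
  then have "k \<in> {1..n} \<Longrightarrow> u k = v k" by (rule cnt_determines)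
  then show "u k = v k"
    using permutes_not_in[OF u, of k] permutes_not_in[OF v, of k] by metis
qed

lemma bruhat_le_trans:
  assumes u: "u permutes {1..n}" and v: "v permutes {1..n}" and w: "w permutes {1..n}"
    and le: "bruhat_le n u v" "bruhat_le n v w"
  shows "bruhat_le n u w"
  using le
  unfolding bruhat_le_iff_cnt[OF u v] bruhat_le_iff_cnt[OF v w] bruhat_le_iff_cnt[OF u w]
  by (meson order.trans)

text \<open>Kept as a relation, not as a maximum: the same \<open>b\<close> is later obtained once
  from the chain and once from the tableau, and \<open>greedy_step_unique\<close> identifies the
  two. The clause \<open>1 \<le> b\<close> keeps \<open>b - 1\<close> from being truncated.\<close>

definition greedy_step :: "(nat \<Rightarrow> nat) \<Rightarrow> (nat \<Rightarrow> nat) \<Rightarrow> nat \<Rightarrow> nat \<Rightarrow> bool" where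
  "greedy_step u w t b \<longleftrightarrow>
     1 \<le> b \<and> b \<le> u (Suc t) \<and> cnt u t (b - 1) = cnt w t (b - 1) \<and>
     (\<forall>x. b \<le> x \<and> x < u (Suc t) \<longrightarrow> cnt w t x < cnt u t x)"

lemma greedy_step_unique:
  assumes "greedy_step u w t b" "greedy_step u w t b'"
  shows "b = b'"
proof -
  have "\<not> b < b'" if "greedy_step u w t b" "greedy_step u w t b'" for b b'
  proof
    assume "b < b'"
    \<comment> \<open>At \<open>b' - 1\<close> the choice \<open>b\<close> demands strict
      inequality, the choice \<open>b'\<close> equality.\<close>
    then have "b \<le> b' - 1" "b' - 1 < u (Suc t)" using that by (auto simp: greedy_step_def)
    then show False using that unfolding greedy_step_def by (metis less_irrefl)
  qed
  then show ?thesis using assms by (meson linorder_neqE_nat)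
qed

section \<open>Minimality of the greedy choice by exchange\<close>

lemma transpose_cnt:
  assumes "1 \<le> k" "k < l"
  shows "cnt (v \<circ> transpose k l) j x + (if k \<le> j \<and> j < l \<and> v k \<le> x then 1 else 0)
       = cnt v j x + (if k \<le> j \<and> j < l \<and> v l \<le> x then 1 else 0)"
proof (induction j)
  case 0
  then show ?case using assms by simp
next
  case (Suc j)
  show ?case
  proof (cases "Suc j = k \<or> Suc j = l")
    case True
    then show ?thesis using Suc assms by (cases "Suc j = k") (auto simp: transpose_def)
  next
    case False
    then have "(k \<le> Suc j \<and> Suc j < l \<and> P) = (k \<le> j \<and> j < l \<and> P)" for P by auto
    moreover have "transpose k l (Suc j) = Suc j" using False by (auto simp: transpose_def)
    ultimately show ?thesis using Suc by simp
  qed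
qed

text \<open>Exchange argument: swapping the first deviation from the greedy choice with the next smaller
  admissible value goes strictly down in Bruhat order without leaving the upper set of \<open>u\<close>.\<close>

lemma exchange_below:
  assumes u: "u permutes {1..n}" and v: "v permutes {1..n}" and w: "w permutes {1..n}"
    and uv: "bruhat_le n u v"
    and pre: "\<And>l. l \<in> {1..q} \<Longrightarrow> v l = w l"
    and greedy: "\<And>t. q \<le> t \<Longrightarrow> t < n \<Longrightarrow> greedy_step u w t (w (Suc t))"
    and neq: "v \<noteq> w"
  obtains v' where "v' permutes {1..n}" "bruhat_le n u v'" "bruhat_le n v' v" "v' \<noteq> v"
    "\<And>l. l \<in> {1..q} \<Longrightarrow> v' l = w l"
proof -
  have uv: "cnt v k x \<le> cnt u k x" if "k \<le> n" for k x
    using uv that u v by (cases "k = 0") (auto simp: bruhat_le_iff_cnt)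
  obtain k0 where "v k0 \<noteq> w k0" using neq by blast
  define k where "k = (LEAST k. v k \<noteq> w k)"
  have k: "v k \<noteq> w k" unfolding k_def by (rule LeastI) fact
  have before: "v l = w l" if "l < k" for l using not_less_Least[OF that[unfolded k_def]] by simp
  have kn: "k \<in> {1..n}" using k permutes_not_in[OF v, of k] permutes_not_in[OF w, of k] by metis
  have kq: "q < k" using pre[of k] k kn by (cases "q < k") auto
  obtain t where t: "k = Suc t" using kq by (cases k) auto
  define b where "b = w k"
  have gr: "greedy_step u w t b" using greedy[of t] kq kn t b_def by auto
  then have b: "1 \<le> b" "b \<le> u k" "cnt u t (b - 1) = cnt w t (b - 1)"
    "\<And>x. b \<le> x \<Longrightarrow> x < u k \<Longrightarrow> cnt w t x < cnt u t x"
    by (auto simp: greedy_step_def t)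
  have vw: "cnt v t x = cnt w t x" for x using before t by (intro cnt_cong) auto
  \<comment> \<open>Otherwise \<open>v k\<close> would add to the count at \<open>b - 1\<close>,
    where \<open>v\<close> and \<open>u\<close> are level before position \<open>k\<close> and
    \<open>u k\<close> adds nothing.\<close>
  have "b \<le> v k"
    using uv[of k "b - 1"] b vw kn by (auto simp: t split: if_splits)
  then have bk: "b < v k" using k b_def by simp
  have "b \<in> {1..n}" using w kn b_def by (metis permutes_in_image)
  then obtain l0 where l0: "v l0 = b" "l0 \<in> {1..n}" using v by (metis permutes_surj permutes_in_image surjD)
  have "k < l0"
  proof (rule ccontr)
    assume "\<not> k < l0"
    then have "l0 = k \<or> l0 < k" by auto
    then have "w l0 = w k" using before l0 b_def k by auto
    then have "l0 = k" using w by (metis permutes_inj injD)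
    then show False using l0 k b_def by simp
  qed
  \<comment> \<open>Taking the first such position keeps the window \<open>[b, v k)\<close> free of
    values of \<open>v\<close> strictly between positions \<open>k\<close> and
    \<open>l\<close>.\<close>
  let ?P = "\<lambda>l. k < l \<and> b \<le> v l \<and> v l < v k"
  define l where "l = (LEAST l. ?P l)"
  have ex: "?P l0" using \<open>k < l0\<close> l0 bk by simp
  have l: "k < l" "b \<le> v l" "v l < v k" using LeastI[where P = ?P, OF ex] unfolding l_def by auto
  have between: "\<not> (b \<le> v i \<and> v i < v k)" if "k < i" "i < l" for i
    using not_less_Least[of i ?P] that unfolding l_def by blast
  have ln: "l \<le> n" using Least_le[where P = ?P, OF ex] l0 unfolding l_def by simp
  define v' where "v' = v \<circ> transpose k l"
  have v': "v' permutes {1..n}"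
    unfolding v'_def using kn ln l by (intro permutes_compose[OF _ v] permutes_swap_id) auto
  \<comment> \<open>The swap raises counts by one where \<open>k \<le> j < l\<close> and
    \<open>v l \<le> x < v k\<close>, and nowhere else; \<open>key\<close> finds the room for this
    below the counts of \<open>u\<close>.\<close>
  have cv': "cnt v' j x = cnt v j x + (if k \<le> j \<and> j < l \<and> v l \<le> x \<and> x < v k then 1 else 0)" for j x
    using transpose_cnt[of k l v j x] kn l by (auto simp: v'_def split: if_splits)
  have key: "cnt v j x < cnt u j x" if j: "k \<le> j" "j < l" and x: "b \<le> x" "x < v k" for j x
  proof -
    \<comment> \<open>Compare the entries with values in \<open>[b, x]\<close>: passing from
      \<open>t\<close> to \<open>j\<close> adds none in \<open>v\<close> (fact 1), passing from
      \<open>k\<close> to \<open>j\<close> loses none in \<open>u\<close> (fact 2), and the counts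
      at \<open>b - 1\<close> agree at the start (fact 4).\<close>
    have 1: "cnt v j x + cnt v t (b - 1) = cnt v t x + cnt v j (b - 1)"
      using j
    proof (induction j rule: dec_induct)
      case base
      then show ?case using bk x by (auto simp: t)
    next
      case (step j)
      then show ?case using between[of "Suc j"] x b by auto
    qed
    have 2: "cnt u k x + cnt u j (b - 1) \<le> cnt u j x + cnt u k (b - 1)"
      using j(1)
    proof (induction j rule: dec_induct)
      case (step j)
      then show ?case using x by auto
    qed simp
    have 3: "cnt v j (b - 1) \<le> cnt u j (b - 1)" using uv j ln by simp
    have 4: "cnt u k (b - 1) = cnt v t (b - 1)" using b vw by (auto simp: t)
    \<comment> \<open>Either the greedy clause gives strictness below \<open>u k\<close>, or
      \<open>u k\<close> itself is an extra entry of \<open>u\<close>.\<close>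
    have 5: "cnt v t x < cnt u k x"
    proof (cases "x < u k")
      case True
      then show ?thesis using b(4)[of x] x vw by (simp add: t)
    next
      case False
      then show ?thesis using uv[of t x] kn by (simp add: t)
    qed
    show ?thesis using 1 2 3 4 5 by linarith
  qed
  show ?thesis
  proof
    show "v' permutes {1..n}" by fact
    have "cnt v' j x \<le> cnt u j x" if "j \<in> {1..n}" for j x
      using cv'[of j x] key[of j x] uv[of j x] that l by (auto split: if_splits)
    then show "bruhat_le n u v'" using u v' by (simp add: bruhat_le_iff_cnt)
    show "bruhat_le n v' v" using v v' cv' by (simp add: bruhat_le_iff_cnt)
    have "v' k = v l" by (simp add: v'_def)
    then show "v' \<noteq> v" using l by auto
    show "v' i = w i" if "i \<in> {1..q}" for i
      using that pre kq l by (simp add: v'_def transpose_def)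
  qed
qed

lemma prefix_iff:
  "w \<in> perms_with_prefix n xs \<longleftrightarrow>
     w permutes {1..n} \<and> (\<forall>l \<in> {1..length xs}. w l = xs ! (l - 1))"
proof -
  have 1: "map w [1..<length xs + 1] = xs \<longleftrightarrow> (\<forall>i < length xs. w (Suc i) = xs ! i)"
    unfolding list_eq_iff_nth_eq by (simp del: upt_Suc)
  have 2: "{1..length xs} = Suc ` {..<length xs}" by (rule image_Suc_lessThan[symmetric])
  show ?thesis unfolding perms_with_prefix_def mem_Collect_eq 1 2 by (auto simp del: image_Suc_lessThan)
qed

lemma greedy_is_minimum:
  assumes u: "u permutes {1..n}" and w: "w \<in> perms_with_prefix n xs" and uw: "bruhat_le n u w"
    and greedy: "\<And>t. length xs \<le> t \<Longrightarrow> t < n \<Longrightarrow> greedy_step u w t (w (Suc t))"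
  shows "(THE v. bruhat_minimal n {v \<in> perms_with_prefix n xs. bruhat_le n u v} v) = w"
proof -
  let ?A = "{v \<in> perms_with_prefix n xs. bruhat_le n u v}"
  have unique: "v = w" if v: "bruhat_minimal n ?A v" for v
  proof (rule ccontr)
    assume neq: "v \<noteq> w"
    have wp: "w permutes {1..n}" "\<And>l. l \<in> {1..length xs} \<Longrightarrow> w l = xs ! (l - 1)"
      using w[unfolded prefix_iff] by simp_all
    have "v \<in> ?A" using v unfolding bruhat_minimal_def by (rule conjunct1)
    then have vA: "v permutes {1..n}" "bruhat_le n u v" "\<And>l. l \<in> {1..length xs} \<Longrightarrow> v l = w l"
      using wp(2) by (simp_all add: prefix_iff)
    obtain v' where "v' permutes {1..n}" "bruhat_le n u v'" "bruhat_le n v' v" "v' \<noteq> v"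
      "\<And>l. l \<in> {1..length xs} \<Longrightarrow> v' l = w l"
      using exchange_below[OF u vA(1) wp(1) vA(2,3) greedy neq] by blast
    moreover from this have "v' \<in> ?A" using wp(2) by (simp add: prefix_iff)
    ultimately show False using v unfolding bruhat_minimal_def by blast
  qed
  have P: "v permutes {1..n}" if "v \<in> ?A" for v using that by (simp add: prefix_iff)
  have "finite {v. v permutes {1..n}}" by (simp add: finite_permutations)
  then have "finite ?A" by (rule rev_finite_subset) (use P in auto)
  moreover have "asymp_on ?A (\<lambda>v v'. bruhat_le n v v' \<and> v \<noteq> v')"
    using bruhat_le_antisym[OF P P] by (intro asymp_onI) blast
  moreover have "transp_on ?A (\<lambda>v v'. bruhat_le n v v' \<and> v \<noteq> v')"
    using bruhat_le_antisym[OF P P] bruhat_le_trans[OF P P P] by (intro transp_onI) blast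
  moreover have "w \<in> ?A" using w uw by simp
  ultimately obtain m where "m \<in> ?A" "\<forall>v \<in> ?A. v \<noteq> m \<longrightarrow> \<not> (bruhat_le n v m \<and> v \<noteq> m)"
    using Finite_Set.bex_min_element[of ?A "\<lambda>v v'. bruhat_le n v v' \<and> v \<noteq> v'"] by blast
  then have m: "bruhat_minimal n ?A m" unfolding bruhat_minimal_def by blast
  then show ?thesis using unique by blast
qed

section \<open>Existence of the greedy permutation with a prescribed prefix\<close>

lemma cnt_pred:
  assumes "inj_on w {1..m}" "1 \<le> x"
  shows "cnt w m x = cnt w m (x - 1) + (if x \<in> w ` {1..m} then 1 else 0)"
  using assms(1)
proof (induction m)
  case (Suc m)
  have "inj_on w {1..m}" using Suc.prems by (rule inj_on_subset) auto
  moreover have "w (Suc m) \<notin> w ` {1..m}"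
  proof
    assume "w (Suc m) \<in> w ` {1..m}"
    then obtain i where i: "i \<in> {1..m}" "w (Suc m) = w i" by blast
    then show False using inj_onD[OF Suc.prems i(2)] by simp
  qed
  moreover have "w ` {1..Suc m} = insert (w (Suc m)) (w ` {1..m})"
    unfolding image_insert[symmetric] by (rule arg_cong[of _ _ "image w"]) auto
  moreover have "w (Suc m) \<le> x \<longleftrightarrow> x = w (Suc m) \<or> w (Suc m) \<le> x - 1"
    "\<not> w (Suc m) \<le> w (Suc m) - 1 \<or> x \<noteq> w (Suc m)"
    using assms(2) by auto
  ultimately show ?case
    using Suc.IH by (cases "x = w (Suc m)"; cases "x \<in> w ` {1..m}") simp_all
qed simp

lemma cnt_at_0: "(\<And>l. l \<in> {1..m} \<Longrightarrow> 1 \<le> w l) \<Longrightarrow> cnt w m 0 = 0"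
  by (fastforce simp: cnt_def)

lemma greedy_step_cong:
  assumes "\<And>l. l \<in> {1..t} \<Longrightarrow> w l = w' l"
  shows "greedy_step u w t b = greedy_step u w' t b"
proof -
  have "cnt w t x = cnt w' t x" for x using assms by (rule cnt_cong)
  then show ?thesis by (simp add: greedy_step_def)
qed

text \<open>No entry is below 1, so 0 is a point of agreement of the counts and a last one before
  \<open>u (Suc m)\<close> exists.\<close>

lemma greedy_extend_one:
  assumes u: "u permutes {1..n}" and "Suc m \<le> n"
    and w: "inj_on w {1..m}" "w ` {1..m} \<subseteq> {1..n}"
    and le: "\<And>x. cnt w m x \<le> cnt u m x"
  obtains b where "greedy_step u w m b" "b \<in> {1..n}" "b \<notin> w ` {1..m}"
proof -
  define a where "a = u (Suc m)"
  have un: "u l \<in> {1..n}" if "l \<in> {1..Suc m}" for l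
    using that assms(2) permutes_in_image[OF u, of l] by auto
  then have a: "1 \<le> a" "a \<le> n" by (auto simp: a_def)
  have inj_u: "inj_on u A" for A using permutes_inj_on[OF u] by blast
  define Z where "Z = {x. x < a \<and> cnt u m x = cnt w m x}"
  have "cnt w m 0 = 0" by (rule cnt_at_0) (use w in force)
  moreover have "cnt u m 0 = 0" by (rule cnt_at_0) (use un in force)
  ultimately have "0 \<in> Z" using a by (simp add: Z_def)
  moreover have fin: "finite Z" by (rule finite_subset[of _ "{..<a}"]) (auto simp: Z_def)
  ultimately have z: "Max Z \<in> Z" using Max_in by blast
  define b where "b = Suc (Max Z)"
  have b: "b \<le> a" "cnt u m (b - 1) = cnt w m (b - 1)" using z by (auto simp: b_def Z_def)
  have strict: "cnt w m x < cnt u m x" if "b \<le> x" "x < a" for x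
  proof -
    have "x \<notin> Z" using Max_ge[OF fin, of x] that b_def by auto
    then show ?thesis using le[of x] that by (auto simp: Z_def)
  qed
  \<comment> \<open>If \<open>b\<close> were used, the count of \<open>w\<close> would jump at
    \<open>b\<close> right after a point of agreement. For \<open>b < a\<close> the count of
    \<open>u\<close> would have to rise by two there; for \<open>b = a\<close> it does not rise at
    all, because \<open>a\<close> is new in \<open>u\<close>.\<close>
  have "b \<notin> w ` {1..m}"
  proof
    assume "b \<in> w ` {1..m}"
    then have 1: "cnt w m b = cnt w m (b - 1) + 1" using cnt_pred[OF w(1), of b] by (simp add: b_def)
    show False
    proof (cases "b < a")
      case True
      then show False using strict[of b] 1 b cnt_pred[OF inj_u, of b m] by (auto simp: b_def split: if_splits)
    next
      case False
      then have "b = a" using b by simp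
      then have "b \<notin> u ` {1..m}" by (auto simp: a_def inj_eq[OF permutes_inj[OF u]])
      then show False using le[of b] 1 b cnt_pred[OF inj_u, of b m] by (simp add: b_def)
    qed
  qed
  moreover have "greedy_step u w m b"
    using b strict by (auto simp: greedy_step_def b_def a_def)
  moreover have "b \<in> {1..n}" using b a by (simp add: b_def)
  ultimately show thesis by (rule that[rotated 2])
qed

lemma greedy_extension:
  assumes u: "u permutes {1..n}" and "q \<le> n"
    and w0: "inj_on w0 {1..q}" "w0 ` {1..q} \<subseteq> {1..n}"
    and le: "\<And>k x. k \<le> q \<Longrightarrow> cnt w0 k x \<le> cnt u k x"
  obtains w where "w permutes {1..n}" "\<And>l. l \<in> {1..q} \<Longrightarrow> w l = w0 l" "bruhat_le n u w"
    "\<And>t. q \<le> t \<Longrightarrow> t < n \<Longrightarrow> greedy_step u w t (w (Suc t))"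
proof -
  have "\<exists>w. inj_on w {1..m} \<and> w ` {1..m} \<subseteq> {1..n} \<and> (\<forall>l \<in> {1..q}. w l = w0 l) \<and>
      (\<forall>k \<le> m. \<forall>x. cnt w k x \<le> cnt u k x) \<and> (\<forall>t. q \<le> t \<and> t < m \<longrightarrow> greedy_step u w t (w (Suc t)))"
    if "q \<le> m" "m \<le> n" for m
    using that
  proof (induction m rule: dec_induct)
    case base
    then show ?case using w0 le by (intro exI[of _ w0]) auto
  next
    case (step m)
    then obtain w where w: "inj_on w {1..m}" "w ` {1..m} \<subseteq> {1..n}" "\<forall>l \<in> {1..q}. w l = w0 l"
      "\<forall>k \<le> m. \<forall>x. cnt w k x \<le> cnt u k x" "\<forall>t. q \<le> t \<and> t < m \<longrightarrow> greedy_step u w t (w (Suc t))"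
      by auto
    obtain b where b: "greedy_step u w m b" "b \<in> {1..n}" "b \<notin> w ` {1..m}"
      using greedy_extend_one[OF u, of m w] w step.prems by auto
    define w' where "w' = w(Suc m := b)"
    have c: "cnt w' k x = cnt w k x" if "k \<le> m" for k x
      using that by (intro cnt_cong) (auto simp: w'_def)
    have g: "greedy_step u w' t y = greedy_step u w t y" if "t \<le> m" for t y
      using that by (intro greedy_step_cong) (auto simp: w'_def)
    have eq: "{1..Suc m} = insert (Suc m) {1..m}" by auto
    have im: "w' ` {1..m} = w ` {1..m}" by (rule image_cong) (auto simp: w'_def)
    have "inj_on w' {1..m}"
      by (subst inj_on_cong[of _ _ w]) (use w(1) in \<open>auto simp: w'_def\<close>)
    moreover have "w' (Suc m) = b" by (simp add: w'_def)
    ultimately have "inj_on w' {1..Suc m}" "w' ` {1..Suc m} \<subseteq> {1..n}"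
      using w(2) b(2,3) im unfolding eq inj_on_insert image_insert by simp_all
    moreover have "\<forall>l \<in> {1..q}. w' l = w0 l" using w(3) step.hyps by (simp add: w'_def)
    \<comment> \<open>For \<open>b \<le> x < u (Suc m)\<close> the new entry of \<open>w'\<close> is
      counted but that of \<open>u\<close> is not; the strict inequality in the greedy clause pays
      for it.\<close>
    moreover have "cnt w' k x \<le> cnt u k x" if "k \<le> Suc m" for k x
    proof (cases "k = Suc m")
      case True
      have "cnt w m x \<le> cnt u m x" using w(4) by blast
      moreover have "cnt w m x < cnt u m x" if "b \<le> x" "x < u (Suc m)"
        using b(1) that by (auto simp: greedy_step_def)
      moreover have "w' (Suc m) = b" by (simp add: w'_def)
      moreover have "b \<le> u (Suc m)" using b(1) by (simp add: greedy_step_def)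
      ultimately show ?thesis using c[of m x] unfolding True by fastforce
    next
      case False
      then show ?thesis using that w(4) c by simp
    qed
    moreover have "greedy_step u w' t (w' (Suc t))" if "q \<le> t" "t < Suc m" for t
      using that w(5) b(1) g[of t] by (cases "t = m") (auto simp: w'_def)
    ultimately show ?case by blast
  qed
  from this[OF \<open>q \<le> n\<close> order.refl] obtain w where
    w: "inj_on w {1..n}" "w ` {1..n} \<subseteq> {1..n}" "\<forall>l \<in> {1..q}. w l = w0 l"
      "\<forall>k \<le> n. \<forall>x. cnt w k x \<le> cnt u k x" "\<forall>t. q \<le> t \<and> t < n \<longrightarrow> greedy_step u w t (w (Suc t))"
    by blast
  define w' where "w' k = (if k \<in> {1..n} then w k else k)" for k
  have "bij_betw w {1..n} {1..n}"
    using w(1,2) by (simp add: bij_betw_def endo_inj_surj)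
  then have "bij_betw w' {1..n} {1..n}" by (subst bij_betw_cong[of _ _ w]) (auto simp: w'_def)
  then have perm: "w' permutes {1..n}" by (rule bij_imp_permutes) (simp only: w'_def if_False)
  have c: "cnt w' k x = cnt w k x" if "k \<le> n" for k x
    using that by (intro cnt_cong) (auto simp: w'_def)
  have g: "greedy_step u w' t y = greedy_step u w t y" if "t \<le> n" for t y
    using that by (intro greedy_step_cong) (auto simp: w'_def)
  show thesis
  proof
    show "w' permutes {1..n}" by fact
    show "w' l = w0 l" if "l \<in> {1..q}" for l using that w(3) \<open>q \<le> n\<close> by (simp add: w'_def)
    show "bruhat_le n u w'" using w(4) c by (simp add: bruhat_le_iff_cnt[OF u perm])
    show "greedy_step u w' t (w' (Suc t))" if "q \<le> t" "t < n" for t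
      using that w(5) g[of t] by (simp add: w'_def)
  qed
qed

lemma greedy_tail:
  assumes u: "u permutes {1..n}" and w: "w permutes {1..n}"
    and greedy: "greedy_step u w t (w (Suc t))" and "t < n"
    and tail: "{1..<u (Suc t)} \<subseteq> u ` {1..t}"
  shows "{1..<w (Suc t)} \<subseteq> w ` {1..t}"
proof -
  define b where "b = w (Suc t)"
  have g: "1 \<le> b" "b \<le> u (Suc t)" "cnt u t (b - 1) = cnt w t (b - 1)"
    using greedy by (auto simp: greedy_step_def b_def)
  have "u ` {1..t} \<subseteq> u ` {1..n}" "w ` {1..t} \<subseteq> w ` {1..n}"
    by (rule image_mono, use \<open>t < n\<close> in auto)+
  then have "u ` {1..t} \<subseteq> {1..n}" "w ` {1..t} \<subseteq> {1..n}"
    by (simp_all only: permutes_image[OF u] permutes_image[OF w])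
  moreover have "A \<inter> {..b - 1} \<subseteq> {1..<b}" if "A \<subseteq> {1..n}" for A
    using that g(1) by auto
  ultimately have sub: "u ` {1..t} \<inter> {..b - 1} \<subseteq> {1..<b}" "w ` {1..t} \<inter> {..b - 1} \<subseteq> {1..<b}"
    by simp_all
  have "{1..<b} \<subseteq> {1..<u (Suc t)}" "{1..<b} \<subseteq> {..b - 1}" using g(2) by auto
  then have "u ` {1..t} \<inter> {..b - 1} = {1..<b}" using sub(1) tail by blast
  then have "card (w ` {1..t} \<inter> {..b - 1}) = card {1..<b}"
    using g(3) cnt_image[OF permutes_inj_on[OF u], of t "b - 1"] cnt_image[OF permutes_inj_on[OF w], of t "b - 1"] by simp
  then have "w ` {1..t} \<inter> {..b - 1} = {1..<b}" using sub(2) by (intro card_subset_eq) auto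
  then show ?thesis unfolding b_def by blast
qed

lemma tail_sorted:
  assumes w: "w permutes {1..n}" and "p \<le> n"
    and tail: "\<And>t. p \<le> t \<Longrightarrow> t < n \<Longrightarrow> {1..<w (Suc t)} \<subseteq> w ` {1..t}"
  shows "map w [p + 1..<n + 1] = sorted_list_of_set ({1..n} - w ` {1..p})"
proof -
  have inj: "w i = w j \<longleftrightarrow> i = j" for i j by (rule inj_eq[OF permutes_inj[OF w]])
  have less: "w k < w l" if "p < k" "k < l" "l \<le> n" for k l
  proof (rule ccontr)
    assume "\<not> w k < w l"
    moreover have "w k \<noteq> w l" using \<open>k < l\<close> inj by simp
    moreover have "1 \<le> w l" using that permutes_in_image[OF w, of l] by simp
    ultimately have "w l \<in> {1..<w k}" by simp
    moreover obtain t where "k = Suc t" using \<open>p < k\<close> by (cases k) auto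
    moreover from this have "p \<le> t" "t < n" using that by simp_all
    ultimately have "w l \<in> w ` {1..t}" using tail[of t] by blast
    then have "l \<in> {1..t}" by (simp add: inj image_iff)
    then show False using \<open>k = Suc t\<close> \<open>k < l\<close> by simp
  qed
  have "sorted_wrt (<) (map w [p + 1..<n + 1])"
    unfolding sorted_wrt_map by (rule sorted_wrt_mono_rel[OF _ sorted_wrt_upt]) (use less in auto)
  then have "sorted_list_of_set (set (map w [p + 1..<n + 1])) = map w [p + 1..<n + 1]"
    by (intro sorted_list_of_set.idem_if_sorted_distinct) (auto simp: strict_sorted_iff)
  moreover have "set (map w [p + 1..<n + 1]) = {1..n} - w ` {1..p}"
  proof -
    have "w ` {p + 1..n} = w ` ({1..n} - {1..p})" by (rule arg_cong[of _ _ "image w"]) auto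
    also have "\<dots> = w ` {1..n} - w ` {1..p}" using permutes_inj[OF w] by (rule image_set_diff)
    finally show ?thesis by (simp only: permutes_image[OF w] set_map set_upt atLeastLessThanSuc_atLeastAtMost Suc_eq_plus1[symmetric])
  qed
  ultimately show ?thesis by (simp only:)
qed

subsection \<open>The minimal chain of a semistandard tableau\<close>

lemma cnt_antimono:
  assumes "\<And>l. l \<in> {1..k} \<Longrightarrow> u l \<le> w l"
  shows "cnt w k x \<le> cnt u k x"
  unfolding cnt_def by (rule card_mono) (use assms order.trans in auto)

lemma increasing_completion_props:
  assumes "distinct xs" "set xs \<subseteq> {1..n}"
  defines "w \<equiv> increasing_completion n xs"
  shows "w permutes {1..n}" "\<And>l. l \<in> {1..length xs} \<Longrightarrow> w l = xs ! (l - 1)" "length xs \<le> n"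
    "\<And>t. length xs \<le> t \<Longrightarrow> t < n \<Longrightarrow> {1..<w (Suc t)} \<subseteq> w ` {1..t}"
proof -
  define zs where "zs = sorted_list_of_set ({1..n} - set xs)"
  define ys where "ys = xs @ zs"
  have ys: "distinct ys" "set ys = {1..n}" using assms by (auto simp: ys_def zs_def)
  then have len: "length ys = n" using distinct_card[of ys] by simp
  then show len_xs: "length xs \<le> n" by (simp add: ys_def)
  have w: "w k = (if k \<in> {1..n} then ys ! (k - 1) else k)" for k
    by (simp add: w_def increasing_completion_def ys_def zs_def)
  have "bij_betw (\<lambda>k. k - 1) {1..n} {..<n}"
    by (rule bij_betw_byWitness[where f' = Suc]) auto
  moreover have "bij_betw ((!) ys) {..<n} {1..n}"
    by (rule bij_betw_nth) (use ys len in auto)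
  ultimately have "bij_betw ((!) ys \<circ> (\<lambda>k. k - 1)) {1..n} {1..n}" by (rule bij_betw_trans)
  then have "bij_betw w {1..n} {1..n}" by (subst bij_betw_cong) (auto simp: w)
  then show "w permutes {1..n}" by (rule bij_imp_permutes) (simp only: w if_False)
  show "w l = xs ! (l - 1)" if "l \<in> {1..length xs}" for l
  proof -
    have "l - 1 < length xs" "l \<in> {1..n}" using that len_xs by auto
    then show ?thesis by (simp add: w ys_def nth_append)
  qed
  show "{1..<w (Suc t)} \<subseteq> w ` {1..t}" if t: "length xs \<le> t" "t < n" for t
  proof
    fix y assume y: "y \<in> {1..<w (Suc t)}"
    have wt: "w (Suc t) = ys ! t" using t by (simp add: w)
    have "ys ! t \<in> {1..n}" using ys len t nth_mem by blast
    then have "y \<in> set ys" using y ys wt by simp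
    then obtain i where i: "i < n" "y = ys ! i" using len by (auto simp: in_set_conv_nth)
    have "\<not> t < i"
    proof
      assume "t < i"
      have "sorted_wrt (<) zs" by (simp add: zs_def)
      moreover have "i - length xs < length zs" using i len t \<open>t < i\<close> by (simp add: ys_def)
      ultimately have "zs ! (t - length xs) < zs ! (i - length xs)"
        using \<open>t < i\<close> t by (simp add: sorted_wrt_nth_less)
      then have "ys ! t < ys ! i" using t \<open>t < i\<close> by (simp add: ys_def nth_append)
      then show False using y i wt by simp
    qed
    moreover have "i \<noteq> t" using y i wt by auto
    ultimately have "Suc i \<in> {1..t}" by simp
    moreover have "w (Suc i) = y" using i by (simp add: w)
    ultimately show "y \<in> w ` {1..t}" by blast
  qed
qed

section \<open>Shape and entries of the tableau\<close>

locale semistandard =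
  fixes n :: nat and S :: tableau
  assumes ssyt: "ssyt n S" and nonempty: "S \<noteq> []"
begin

definition "p = length S"
definition "c = num_cols S"
definition "entry r j = S ! (r - 1) ! (j - 1)"
definition "row_length r = length (S ! (r - 1))"
definition "col_length j = length (tab_column S j)"

lemma p_pos: "1 \<le> p"
  using nonempty by (simp add: p_def Suc_le_eq)

lemma row_in_set: "r \<in> {1..p} \<Longrightarrow> S ! (r - 1) \<in> set S"
  by (auto simp: p_def)

lemma row_length_1: "row_length 1 = c"
  using nonempty by (auto simp: row_length_def c_def num_cols_def split: list.split)

lemma row_length_antimono:
  assumes "1 \<le> r" "r \<le> r'" "r' \<le> p"
  shows "row_length r' \<le> row_length r"
proof (cases "r = r'")
  case False
  have "sorted_wrt (\<ge>) (map length S)" using ssyt by (simp add: ssyt_def)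
  then show ?thesis
    using sorted_wrt_nth_less[of "(\<ge>)" "map length S" "r - 1" "r' - 1"] False assms
    by (auto simp: row_length_def p_def)
qed simp

lemma row_length_le: "r \<in> {1..p} \<Longrightarrow> row_length r \<le> c"
  using row_length_antimono[of 1 r] row_length_1 by simp

lemma row_length_pos: "r \<in> {1..p} \<Longrightarrow> 1 \<le> row_length r"
  using row_in_set[of r] ssyt by (auto simp: row_length_def ssyt_def Suc_le_eq)

lemma c_pos: "1 \<le> c"
  using row_length_pos[of 1] p_pos row_length_1 by simp

lemma entry_range:
  assumes "r \<in> {1..p}" "j \<in> {1..row_length r}"
  shows "entry r j \<in> {1..n}"
proof -
  have "j - 1 < length (S ! (r - 1))" using assms(2) by (auto simp: row_length_def)
  then have "entry r j \<in> set (S ! (r - 1))" unfolding entry_def by (rule nth_mem)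
  moreover have "set (S ! (r - 1)) \<subseteq> {1..n}" using ssyt row_in_set[OF assms(1)] by (simp add: ssyt_def)
  ultimately show ?thesis by blast
qed

lemma entry_row_mono:
  assumes "r \<in> {1..p}" "1 \<le> j" "j \<le> j'" "j' \<le> row_length r"
  shows "entry r j \<le> entry r j'"
proof -
  have "sorted (S ! (r - 1))" using ssyt row_in_set[OF assms(1)] by (simp add: ssyt_def)
  then show ?thesis using assms unfolding entry_def row_length_def
    by (intro sorted_nth_mono) auto
qed

text \<open>Row lengths decrease weakly, so the rows that reach column \<open>j\<close> are the
  first ones and \<open>filter\<close> acts as \<open>takeWhile\<close>; hence entry
  \<open>r\<close> of the column comes from row \<open>r\<close>.\<close>

lemma tab_column_eq:
  shows "r \<in> {1..p} \<Longrightarrow> r \<le> col_length j \<longleftrightarrow> j \<le> row_length r"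
    and "col_length j \<le> p"
    and "r \<in> {1..col_length j} \<Longrightarrow> tab_column S j ! (r - 1) = entry r j"
proof -
  let ?P = "\<lambda>row. j \<le> length row" and ?K = "length (takeWhile (\<lambda>row. j \<le> length row) S)"
  have "filter (\<lambda>row. j \<le> length row) xs = takeWhile (\<lambda>row. j \<le> length row) xs"
    if "sorted_wrt (\<ge>) (map length xs)" for xs :: tableau
    using that
  proof (induction xs)
    case (Cons a xs)
    show ?case
    proof (cases "j \<le> length a")
      case False
      have "\<forall>row \<in> set xs. length row \<le> length a" using Cons.prems by simp
      then have "filter (\<lambda>row. j \<le> length row) xs = []"
        unfolding filter_empty_conv using False by (meson order.trans)
      then show ?thesis using False by simp
    qed (use Cons in simp)
  qed simp
  then have col: "tab_column S j = map (\<lambda>row. row ! (j - 1)) (takeWhile ?P S)"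
    using ssyt by (simp add: tab_column_def ssyt_def)
  then have K: "col_length j = ?K" by (simp add: col_length_def)
  show "col_length j \<le> p" unfolding K p_def by (rule length_takeWhile_le)
  show "r \<le> col_length j \<longleftrightarrow> j \<le> row_length r" if r: "r \<in> {1..p}"
  proof
    assume "r \<le> col_length j"
    then have lt: "r - 1 < ?K" using r K by auto
    then have "takeWhile ?P S ! (r - 1) \<in> set (takeWhile ?P S)" by (rule nth_mem)
    then show "j \<le> row_length r"
      using takeWhile_nth[OF lt] by (auto dest: set_takeWhileD simp: row_length_def)
  next
    assume le: "j \<le> row_length r"
    show "r \<le> col_length j"
    proof (rule ccontr)
      assume "\<not> r \<le> col_length j"
      then have lt: "?K < length S" "Suc ?K \<le> r" using r K by (auto simp: p_def)
      then have "\<not> j \<le> row_length (Suc ?K)"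
        using nth_length_takeWhile[of ?P S] by (simp add: row_length_def)
      then show False using row_length_antimono[of "Suc ?K" r] lt r le by simp
    qed
  qed
  show "tab_column S j ! (r - 1) = entry r j" if "r \<in> {1..col_length j}"
  proof -
    have lt: "r - 1 < ?K" using that K by auto
    then show ?thesis unfolding col entry_def by (simp add: takeWhile_nth)
  qed
qed

lemma entry_col_mono:
  assumes "1 \<le> r" "r < r'" "r' \<le> p" "j \<in> {1..row_length r'}"
  shows "entry r j < entry r' j"
proof -
  have "j \<in> {1..c}" using assms row_length_le[of r'] by auto
  then have "sorted_wrt (<) (tab_column S j)" using ssyt by (simp add: ssyt_def c_def)
  moreover have K: "r' \<le> col_length j" using tab_column_eq(1)[of r' j] assms by simp
  ultimately have "tab_column S j ! (r - 1) < tab_column S j ! (r' - 1)"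
    using assms sorted_wrt_nth_less[of "(<)" "tab_column S j" "r - 1" "r' - 1"]
    by (simp add: col_length_def)
  then show ?thesis using tab_column_eq(3)[of r j] tab_column_eq(3)[of r' j] K assms by simp
qed

section \<open>The chain, column by column\<close>

abbreviation "chain \<equiv> min_chain n S"

lemma col_length_antimono: "1 \<le> j \<Longrightarrow> col_length (Suc j) \<le> col_length j"
  using tab_column_eq(1)[of "col_length (Suc j)" "Suc j"] tab_column_eq(1)[of "col_length (Suc j)" j]
    tab_column_eq(2)[of "Suc j"] by (cases "col_length (Suc j) = 0") auto

lemma column_inj: "inj_on (\<lambda>l. entry l j) {1..col_length j}" if "1 \<le> j"
proof (rule linorder_inj_onI)
  fix r r' assume "r < r'" "r \<in> {1..col_length j}" "r' \<in> {1..col_length j}"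
  then have "entry r j < entry r' j"
    using that tab_column_eq(1)[of r' j] tab_column_eq(2)[of j] by (intro entry_col_mono) auto
  then show "entry r j \<noteq> entry r' j" by simp
qed auto

lemma column_range: "(\<lambda>l. entry l j) ` {1..col_length j} \<subseteq> {1..n}" if "1 \<le> j"
proof (rule image_subsetI)
  fix l assume l: "l \<in> {1..col_length j}"
  then show "entry l j \<in> {1..n}"
    using that tab_column_eq(1)[of l j] tab_column_eq(2)[of j] by (intro entry_range) auto
qed

lemma set_tab_column: "set (tab_column S j) = (\<lambda>l. entry l j) ` {1..col_length j}"
proof -
  have "set (tab_column S j) = (!) (tab_column S j) ` {..<col_length j}"
    by (auto simp: set_conv_nth col_length_def)
  also have "\<dots> = (\<lambda>l. tab_column S j ! (l - 1)) ` {1..col_length j}"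
    unfolding image_Suc_lessThan[symmetric] image_image by simp
  also have "\<dots> = (\<lambda>l. entry l j) ` {1..col_length j}"
    by (rule image_cong) (simp_all add: tab_column_eq(3)[simplified])
  finally show ?thesis .
qed

lemma chain_first:
  "chain 1 permutes {1..n}" "l \<in> {1..p} \<Longrightarrow> chain 1 l = entry l 1" "p \<le> n"
  "p \<le> t \<Longrightarrow> t < n \<Longrightarrow> {1..<chain 1 (Suc t)} \<subseteq> chain 1 ` {1..t}"
proof -
  have K: "length (tab_column S 1) = p"
    using tab_column_eq(1)[of p 1] tab_column_eq(2)[of 1] row_length_pos[of p] p_pos
    by (simp add: col_length_def)
  have "distinct (tab_column S 1)"
    using ssyt c_pos by (auto simp: ssyt_def strict_sorted_iff c_def)
  moreover have "set (tab_column S 1) \<subseteq> {1..n}"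
    unfolding set_tab_column by (rule column_range) simp
  ultimately have ic: "chain 1 permutes {1..n}" "\<And>l. l \<in> {1..p} \<Longrightarrow> chain 1 l = tab_column S 1 ! (l - 1)"
    "p \<le> n" "\<And>t. p \<le> t \<Longrightarrow> t < n \<Longrightarrow> {1..<chain 1 (Suc t)} \<subseteq> chain 1 ` {1..t}"
    using increasing_completion_props[of "tab_column S 1" n, unfolded K] by simp_all
  show "chain 1 permutes {1..n}" "p \<le> n" by fact+
  show "p \<le> t \<Longrightarrow> t < n \<Longrightarrow> {1..<chain 1 (Suc t)} \<subseteq> chain 1 ` {1..t}" by (rule ic(4))
  show "l \<in> {1..p} \<Longrightarrow> chain 1 l = entry l 1"
    using ic(2)[of l] tab_column_eq(3)[of l 1] K by (simp add: col_length_def)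
qed

text \<open>Rows of \<open>S\<close> increase weakly, so column \<open>Suc i\<close> dominates the
  prefix of \<open>chain i\<close> and has a greedy extension above it; this extension is the
  minimum that defines the next member. The hypothesis \<open>pre\<close> makes the comparison
  possible and is reproduced by the conclusion.\<close>

lemma chain_step:
  assumes u: "chain i permutes {1..n}" and i: "1 \<le> i"
    and pre: "\<And>l. l \<in> {1..col_length i} \<Longrightarrow> chain i l = entry l i"
  shows "chain (Suc i) permutes {1..n} \<and>
    (\<forall>l \<in> {1..col_length (Suc i)}. chain (Suc i) l = entry l (Suc i)) \<and>
    (\<forall>t. col_length (Suc i) \<le> t \<and> t < n \<longrightarrow>
       greedy_step (chain i) (chain (Suc i)) t (chain (Suc i) (Suc t)))"
proof -
  define q where "q = col_length (Suc i)"
  have q: "q \<le> col_length i" "q \<le> p" using col_length_antimono[OF i] tab_column_eq(2) by (simp_all add: q_def)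
  have inj: "inj_on (\<lambda>l. entry l (Suc i)) {1..q}" unfolding q_def by (rule column_inj) simp
  have ran: "(\<lambda>l. entry l (Suc i)) ` {1..q} \<subseteq> {1..n}" unfolding q_def by (rule column_range) simp
  have le: "cnt (\<lambda>l. entry l (Suc i)) k x \<le> cnt (chain i) k x" if "k \<le> q" for k x
  proof (rule cnt_antimono)
    fix l assume l: "l \<in> {1..k}"
    then have "entry l i \<le> entry l (Suc i)"
      using that q i tab_column_eq(1)[of l "Suc i"] by (intro entry_row_mono) (auto simp: q_def)
    then show "chain i l \<le> entry l (Suc i)" using pre[of l] l that q by simp
  qed
  obtain w where w: "w permutes {1..n}" "\<And>l. l \<in> {1..q} \<Longrightarrow> w l = entry l (Suc i)"
    "bruhat_le n (chain i) w" "\<And>t. q \<le> t \<Longrightarrow> t < n \<Longrightarrow> greedy_step (chain i) w t (w (Suc t))"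
    using greedy_extension[OF u _ inj ran le] q(2) chain_first(3) by (metis order.trans)
  have "w \<in> perms_with_prefix n (tab_column S (Suc i))"
    unfolding prefix_iff using w(1,2) tab_column_eq(3)[of _ "Suc i"] by (simp add: q_def col_length_def)
  then have "(THE v. bruhat_minimal n {v \<in> perms_with_prefix n (tab_column S (Suc i)). bruhat_le n (chain i) v} v) = w"
    using w(3,4) by (intro greedy_is_minimum[OF u]) (auto simp: q_def col_length_def)
  moreover obtain i' where "i = Suc i'" using i by (cases i) auto
  ultimately have "chain (Suc i) = w" by simp
  then show ?thesis using w by (simp add: q_def)
qed

lemma chain_prefix:
  assumes "1 \<le> i"
  shows "chain i permutes {1..n} \<and> (\<forall>l \<in> {1..col_length i}. chain i l = entry l i)"
  using assms
proof (induction i rule: dec_induct)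
  case base
  show ?case using chain_first(1,2) tab_column_eq(2)[of 1] by auto
next
  case (step i)
  then show ?case using chain_step[of i] by blast
qed

lemma chain_permutes: "1 \<le> i \<Longrightarrow> chain i permutes {1..n}"
  using chain_prefix by blast

lemma chain_entry:
  assumes "l \<in> {1..p}" "i \<in> {1..row_length l}"
  shows "chain i l = entry l i"
  using chain_prefix[of i] tab_column_eq(1)[of l i] assms by simp

text \<open>Where row \<open>k\<close> has ended, position \<open>k\<close> lies beyond the
  prescribed prefix of the column and is therefore filled greedily.\<close>

lemma chain_greedy:
  assumes "k \<in> {1..p}" "row_length k < Suc i" "1 \<le> i"
  shows "greedy_step (chain i) (chain (Suc i)) (k - 1) (chain (Suc i) k)"
proof -
  have "col_length (Suc i) \<le> k - 1" using tab_column_eq(1)[of k "Suc i"] assms by auto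
  moreover have "k - 1 < n" "Suc (k - 1) = k" using assms chain_first(3) by auto
  ultimately show ?thesis using chain_step[of i] chain_prefix[of i] assms(3) by metis
qed

lemma chain_tail:
  assumes "1 \<le> i"
  shows "p \<le> t \<Longrightarrow> t < n \<Longrightarrow> {1..<chain i (Suc t)} \<subseteq> chain i ` {1..t}"
  using assms
proof (induction i arbitrary: t rule: dec_induct)
  case base
  then show ?case by (rule chain_first(4))
next
  case (step i)
  have "col_length (Suc i) \<le> t" using tab_column_eq(2)[of "Suc i"] step.prems by simp
  then have "greedy_step (chain i) (chain (Suc i)) t (chain (Suc i) (Suc t))"
    using chain_step[of i] chain_prefix[of i] step by blast
  moreover have "{1..<chain i (Suc t)} \<subseteq> chain i ` {1..t}" by (rule step.IH) (use step.prems in simp_all)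
  ultimately show ?case
    using step by (intro greedy_tail[OF chain_permutes[of i] chain_permutes[of "Suc i"]]) simp_all
qed

end

subsection \<open>One push-down step\<close>

text \<open>\<open>V\<close> is the array obtained from the first \<open>r\<close> rows of \<open>T\<close> by filling every empty box from the left.\<close>

definition reads :: "nat \<Rightarrow> nat \<Rightarrow> nat config \<Rightarrow> (nat \<Rightarrow> nat \<Rightarrow> nat) \<Rightarrow> bool" where
  "reads c r T V \<longleftrightarrow> (\<forall>l. T 0 l = None) \<and>
     (\<forall>q \<in> {1..r}. T q 1 \<noteq> None \<and>
        (\<forall>l. case T q l of Some y \<Rightarrow> l \<in> {1..c} \<and> y = V q l
                        | None \<Rightarrow> l \<in> {2..c} \<longrightarrow> V q l = V q (l - 1)))"

text \<open>\<open>m q\<close> is the first column of row \<open>q\<close> that is pushed down (\<open>c + 1\<close> if there is none), and \<open>e q\<close> is the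
  value of \<open>e'\<close> in row \<open>q\<close>; \<open>m (Suc r)\<close> is the column after the initial position of \<open>e'\<close>.\<close>

definition cuts :: "nat \<Rightarrow> nat \<Rightarrow> (nat \<Rightarrow> nat \<Rightarrow> nat) \<Rightarrow> (nat \<Rightarrow> nat) \<Rightarrow> (nat \<Rightarrow> nat) \<Rightarrow> bool" where
  "cuts c r V m e \<longleftrightarrow> m 0 = c + 1 \<and> 2 \<le> m (Suc r) \<and> m (Suc r) \<le> c + 1 \<and>
     (\<forall>q \<in> {1..r}. m (Suc q) \<le> m q \<and> m q \<le> c + 1 \<and> e q = V q (m q - 1) \<and>
        (\<forall>l \<in> {1..c}. l < m q \<longleftrightarrow> V q l < e (Suc q)))"

section \<open>Cut columns and thresholds\<close>

lemma cutsD: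
  assumes "cuts c r V m e"
  shows "m 0 = c + 1" "q \<in> {1..r} \<Longrightarrow> e q = V q (m q - 1)"
    "q \<in> {1..r} \<Longrightarrow> l \<in> {1..c} \<Longrightarrow> l < m q \<longleftrightarrow> V q l < e (Suc q)"
  using assms unfolding cuts_def by blast+

lemma cuts_antimono:
  assumes "cuts c r V m e" "b \<le> Suc r" "a \<le> b"
  shows "m b \<le> m a"
  using assms(3,2)
proof (induction b rule: dec_induct)
  case (step b)
  have "m (Suc b) \<le> m b"
  proof (cases "b = 0")
    case True
    have "m 1 \<le> c + 1" using assms(1) by (cases r) (auto simp: cuts_def)
    then show ?thesis using cutsD(1)[OF assms(1)] True by simp
  next
    case False
    then have "b \<in> {1..r}" using step by auto
    then show ?thesis using assms(1) unfolding cuts_def by blast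
  qed
  then show ?case using step by simp
qed simp

lemma cuts_bounds: "cuts c r V m e \<Longrightarrow> q \<le> Suc r \<Longrightarrow> 2 \<le> m q \<and> m q \<le> c + 1"
  using cuts_antimono[of c r V m e "Suc r" q] cuts_antimono[of c r V m e q 0] by (auto simp: cuts_def)

lemma cuts_pred: "cuts c (Suc r) V m e \<Longrightarrow> cuts c r V m e"
  using cuts_bounds[of c "Suc r" V m e "Suc r"] by (auto simp: cuts_def)

text \<open>Built from the bottom row upwards. The start condition \<open>top\<close> reproduces
  itself: the next threshold is \<open>V (Suc r) (M - 1)\<close>, and the entry above it is smaller
  because columns increase strictly.\<close>

lemma cuts_exist:
  fixes V :: "nat \<Rightarrow> nat \<Rightarrow> nat"
  assumes "2 \<le> m0" "m0 \<le> c + 1"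
    and rows: "\<And>q l l'. q \<in> {1..r} \<Longrightarrow> 1 \<le> l \<Longrightarrow> l \<le> l' \<Longrightarrow> l' \<le> c \<Longrightarrow> V q l \<le> V q l'"
    and cols: "\<And>q l. 1 \<le> q \<Longrightarrow> q < r \<Longrightarrow> l \<in> {1..c} \<Longrightarrow> V q l < V (Suc q) l"
    and top: "1 \<le> r \<Longrightarrow> V r (m0 - 1) < e0"
  shows "\<exists>m e. cuts c r V m e \<and> m (Suc r) = m0 \<and> e (Suc r) = e0"
  using assms
proof (induction r arbitrary: m0 e0)
  case 0
  then show ?case
    by (intro exI[of _ "\<lambda>q. if q = 0 then c + 1 else m0"] exI[of _ "\<lambda>_. e0"]) (simp add: cuts_def)
next
  case (Suc r)
  \<comment> \<open>The column \<open>c + 1\<close> marks a row without a cut; requiring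
    \<open>m0 \<le> l\<close> builds in that cuts move weakly right on the way up.\<close>
  let ?P = "\<lambda>l. m0 \<le> l \<and> (l = c + 1 \<or> e0 \<le> V (Suc r) l)"
  define M where "M = (LEAST l. ?P l)"
  have "?P (c + 1)" using Suc.prems by simp
  then have M: "?P M" "M \<le> c + 1"
    unfolding M_def by (rule LeastI[where P = ?P], rule Least_le[where P = ?P])
  have iff: "l < M \<longleftrightarrow> V (Suc r) l < e0" if l: "l \<in> {1..c}" for l
  proof
    assume "l < M"
    show "V (Suc r) l < e0"
    proof (cases "l < m0")
      case True
      then have "V (Suc r) l \<le> V (Suc r) (m0 - 1)" using l Suc.prems(1,2) by (intro Suc.prems(3)) auto
      then show ?thesis using Suc.prems(5) by simp
    next
      case False
      then show ?thesis using not_less_Least[of l ?P] \<open>l < M\<close> unfolding M_def by auto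
    qed
  next
    assume lt: "V (Suc r) l < e0"
    show "l < M"
    proof (rule ccontr)
      assume "\<not> l < M"
      then have "V (Suc r) M \<le> V (Suc r) l" "e0 \<le> V (Suc r) M"
        using l M Suc.prems(1) by (auto intro!: Suc.prems(3))
      then show False using lt by simp
    qed
  qed
  have M1: "M - 1 \<in> {1..c}" "M - 1 < M" using M Suc.prems(1) by auto
  have "\<exists>m e. cuts c r V m e \<and> m (Suc r) = M \<and> e (Suc r) = V (Suc r) (M - 1)"
    by (rule Suc.IH) (use M M1 Suc.prems in auto)
  then obtain m e where me: "cuts c r V m e" "m (Suc r) = M" "e (Suc r) = V (Suc r) (M - 1)" by blast
  define m' where "m' = m(Suc (Suc r) := m0)"
  define e' where "e' = e(Suc (Suc r) := e0)"
  have "cuts c (Suc r) V m' e'"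
    unfolding cuts_def
  proof (intro conjI ballI)
    show "m' 0 = c + 1" "2 \<le> m' (Suc (Suc r))" "m' (Suc (Suc r)) \<le> c + 1"
      using me(1) Suc.prems(1,2) by (simp_all add: m'_def cuts_def)
  next
    fix q assume q: "q \<in> {1..Suc r}"
    show "m' (Suc q) \<le> m' q"
      using q me(1,2) M by (cases "q = Suc r") (auto simp: m'_def cuts_def)
    show "m' q \<le> c + 1"
      using q me(1,2) M by (cases "q = Suc r") (auto simp: m'_def cuts_def)
    show "e' q = V q (m' q - 1)"
      using q me by (cases "q = Suc r") (auto simp: m'_def e'_def cuts_def)
    fix l assume l: "l \<in> {1..c}"
    show "l < m' q \<longleftrightarrow> V q l < e' (Suc q)"
      using q l me iff[OF l] by (cases "q = Suc r") (auto simp: m'_def e'_def cuts_def)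
  qed
  moreover have "m' (Suc (Suc r)) = m0" "e' (Suc (Suc r)) = e0" by (simp_all add: m'_def e'_def)
  ultimately show ?case by blast
qed

text \<open>At the cut the value jumps across the threshold, which an empty box, repeating its left
  neighbour, cannot do.\<close>

lemma cut_nonempty:
  assumes "reads c r T V" "cuts c r V m e" "q \<in> {1..r}" "m q \<le> c"
  shows "T q (m q) \<noteq> None"
proof
  assume None: "T q (m q) = None"
  have b: "2 \<le> m q" using cuts_bounds[OF assms(2), of q] assms(3) by simp
  have "case T q (m q) of Some y \<Rightarrow> m q \<in> {1..c} \<and> y = V q (m q)
       | None \<Rightarrow> m q \<in> {2..c} \<longrightarrow> V q (m q) = V q (m q - 1)"
    using assms(1,3) unfolding reads_def by blast
  then have "V q (m q) = V q (m q - 1)" using None b assms(4) by simp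
  moreover have in_range: "m q - 1 \<in> {1..c}" "m q \<in> {1..c}" using b assms(4) by auto
  then have "V q (m q - 1) < e (Suc q)" "\<not> V q (m q) < e (Suc q)"
    using cutsD(3)[OF assms(2,3) in_range(1)] cutsD(3)[OF assms(2,3) in_range(2)] b by simp_all
  ultimately show False by simp
qed

text \<open>Between the last nonempty box before \<open>M\<close> and column \<open>M\<close> all
  boxes are empty, so the filled values stay constant there. Hence the \<open>e'\<close> that
  \<open>pushes\<close> finds across gaps has the filled value next to the cut.\<close>

lemma last_retained:
  assumes "reads c r T V" "q \<in> {1..r}" "2 \<le> M" "M \<le> c + 1"
  shows "the (T q (Max {l. l < M \<and> T q l \<noteq> None})) = V q (M - 1)"
proof -
  let ?L = "{l. l < M \<and> T q l \<noteq> None}"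
  define j where "j = Max ?L"
  have rd: "case T q l of Some y \<Rightarrow> l \<in> {1..c} \<and> y = V q l
       | None \<Rightarrow> l \<in> {2..c} \<longrightarrow> V q l = V q (l - 1)" "T q 1 \<noteq> None" for l
    using assms(1,2) unfolding reads_def by blast+
  have fin: "finite ?L" by (rule finite_subset[of _ "{..<M}"]) auto
  have "1 \<in> ?L" using rd(2) assms(3) by simp
  then have "?L \<noteq> {}" by (metis empty_iff)
  then have "j \<in> ?L" unfolding j_def by (rule Max_in[OF fin])
  then obtain y where y: "T q j = Some y" "j < M" by blast
  have j: "1 \<le> j" "y = V q j" using rd(1)[of j] y by auto
  have const: "V q l = V q j" if "j \<le> l" "l \<le> M - 1" for l
    using that
  proof (induction l rule: dec_induct)
    case (step l)
    have "\<not> Suc l \<in> ?L"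
    proof
      assume "Suc l \<in> ?L"
      then have "Suc l \<le> j" unfolding j_def by (rule Max_ge[OF fin])
      then show False using step by simp
    qed
    then have "T q (Suc l) = None" using step.prems by auto
    then have "V q (Suc l) = V q l" using rd(1)[of "Suc l"] step j assms(4) by auto
    then show ?case using step by simp
  qed simp
  have "V q (M - 1) = V q j" by (rule const) (use y in simp_all)
  then show ?thesis using y j by (simp add: j_def)
qed

text \<open>The shifts are computed from \<open>T\<close> but applied to an arbitrary
  \<open>U\<close>, since the same moves act on the bare and on the coloured configuration. They run
  upwards, so a cut row hands down its right part before it receives the one from above.\<close>

lemma fold_pushes:
  assumes "reads c r T V" "cuts c r V m e" "the (T (Suc r) j) = e (Suc r)" "l \<in> {1..c}"
  shows "fold shift_down (pushes T (Suc r) j) U q l =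
    (if 1 \<le> q \<and> q \<le> Suc r \<and> m (q - 1) \<le> l then U (q - 1) l
     else if q \<le> r \<and> m q \<le> l then None else U q l)"
  using assms(1-3)
proof (induction r arbitrary: T U j)
  case 0
  then have "{m. \<exists>y. T 0 m = Some y \<and> the (T (Suc 0) j) \<le> y} = {}" by (simp add: reads_def)
  moreover have "m 0 = c + 1" using 0 cutsD(1) by blast
  ultimately show ?case using assms(4) by (cases "q = 1") auto
next
  case (Suc r)
  define M where "M = m (Suc r)"
  have M: "2 \<le> M" "M \<le> c + 1" using cuts_bounds[OF Suc.prems(2), of "Suc r"] by (simp_all add: M_def)
  define C where "C = {x. \<exists>y. T (Suc r) x = Some y \<and> the (T (Suc (Suc r)) j) \<le> y}"
  have C: "M \<le> x \<and> x \<le> c" if "x \<in> C" for x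
  proof -
    obtain y where y: "T (Suc r) x = Some y" "e (Suc (Suc r)) \<le> y"
      using \<open>x \<in> C\<close> Suc.prems(3) by (auto simp: C_def)
    have "case T (Suc r) x of Some y \<Rightarrow> x \<in> {1..c} \<and> y = V (Suc r) x
       | None \<Rightarrow> x \<in> {2..c} \<longrightarrow> V (Suc r) x = V (Suc r) (x - 1)"
      using Suc.prems(1) unfolding reads_def by auto
    then have "x \<in> {1..c}" "y = V (Suc r) x" using y by auto
    then show ?thesis using cutsD(3)[OF Suc.prems(2), of "Suc r" x] y by (simp add: M_def)
  qed
  show ?case
  proof (cases "M = c + 1")
    case True
    \<comment> \<open>Without a cut here \<open>pushes\<close> stops, and by monotonicity no row
      above is cut either, as the formula requires.\<close>
    then have "C = {}" using C by fastforce
    then have "pushes T (Suc (Suc r)) j = []" unfolding C_def by simp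
    moreover have "\<not> m q' \<le> l" if "q' \<le> Suc r" for q'
      using cuts_antimono[OF Suc.prems(2), of "Suc r" q'] that True assms(4) by (simp add: M_def)
    ultimately show ?thesis by (auto simp del: pushes.simps)
  next
    case False
    then have "T (Suc r) M \<noteq> None"
      using cut_nonempty[OF Suc.prems(1,2), of "Suc r"] M by (simp add: M_def)
    then obtain y where y: "T (Suc r) M = Some y" by blast
    have "case T (Suc r) M of Some y \<Rightarrow> M \<in> {1..c} \<and> y = V (Suc r) M
       | None \<Rightarrow> M \<in> {2..c} \<longrightarrow> V (Suc r) M = V (Suc r) (M - 1)"
      using Suc.prems(1) unfolding reads_def by auto
    then have "y = V (Suc r) M" "M \<in> {1..c}" using y by auto
    then have MC: "M \<in> C"
      using y Suc.prems(3) cutsD(3)[OF Suc.prems(2), of "Suc r" M] by (auto simp: C_def M_def)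
    have least: "(LEAST x. x \<in> C) = M"
      by (rule Least_equality) (use MC C in auto)
    define T' where "T' = shift_down (Suc r, M) T"
    define U' where "U' = shift_down (Suc r, M) U"
    define j' where "j' = Max {l. l < M \<and> T' (Suc r) l \<noteq> None}"
    have "pushes T (Suc (Suc r)) j = (Suc r, M) # pushes T' (Suc r) j'"
      using MC least by (auto simp: C_def[symmetric] Let_def T'_def j'_def)
    then have "fold shift_down (pushes T (Suc (Suc r)) j) U = fold shift_down (pushes T' (Suc r) j') U'"
      by (simp add: U'_def)
    moreover have low: "T' q = T q" if "q \<le> r" for q
      using that by (auto simp: T'_def shift_down_def)
    \<comment> \<open>The search for the next \<open>e'\<close> looks only left of \<open>M\<close>,
      where the shift changed nothing.\<close>
    have T'r: "T' (Suc r) x = T (Suc r) x" if "x < M" for x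
      using that by (simp add: T'_def shift_down_def)
    have "reads c r T' V"
      using Suc.prems(1) low unfolding reads_def by auto
    moreover have "the (T' (Suc r) j') = e (Suc r)"
    proof -
      have "{l. l < M \<and> T' (Suc r) l \<noteq> None} = {l. l < M \<and> T (Suc r) l \<noteq> None}" using T'r by auto
      then have j'_eq: "j' = Max {l. l < M \<and> T (Suc r) l \<noteq> None}" by (simp add: j'_def)
      have "T (Suc r) 1 \<noteq> None" using Suc.prems(1) unfolding reads_def by auto
      then have "{l. l < M \<and> T (Suc r) l \<noteq> None} \<noteq> {}" using M(1) by force
      moreover have "finite {l. l < M \<and> T (Suc r) l \<noteq> None}" by (rule finite_subset[of _ "{..<M}"]) auto
      ultimately have "j' \<in> {l. l < M \<and> T (Suc r) l \<noteq> None}" unfolding j'_eq by (rule Max_in[rotated])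
      then have "the (T' (Suc r) j') = the (T (Suc r) j')" using T'r by simp
      also have "\<dots> = V (Suc r) (M - 1)"
        unfolding j'_eq using last_retained[OF Suc.prems(1), of "Suc r" M] M by simp
      also have "\<dots> = e (Suc r)" using cutsD(2)[OF Suc.prems(2), of "Suc r"] by (simp add: M_def)
      finally show ?thesis .
    qed
    ultimately have "fold shift_down (pushes T (Suc (Suc r)) j) U q l =
      (if 1 \<le> q \<and> q \<le> Suc r \<and> m (q - 1) \<le> l then U' (q - 1) l
       else if q \<le> r \<and> m q \<le> l then None else U' q l)"
      using Suc.IH[of T' j' U'] cuts_pred[OF Suc.prems(2)] by simp
    moreover have "U' q l = (if l < M then U q l else if q = Suc r then None else if q = Suc (Suc r) then U (Suc r) l else U q l)" for q
      by (simp add: U'_def shift_down_def)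
    ultimately show ?thesis by (auto simp: M_def le_Suc_eq)
  qed
qed

section \<open>Filling a row and counting in a column\<close>

lemma fold_shift_down_None:
  assumes "\<And>q. U q l = None"
  shows "fold shift_down ps U q l = None"
  using assms
proof (induction ps arbitrary: U q)
  case (Cons s ps)
  have "shift_down s U q l = None" for q
    using Cons.prems by (cases s) (simp add: shift_down_def)
  then show ?case using Cons.IH by simp
qed simp

lemma fill_row_Some: "R l = Some x \<Longrightarrow> fill_row k R l = Some x"
  by (cases l) auto

lemma fill_row_None:
  assumes "R a = Some (v, d)" "a < l" "\<And>x. a < x \<Longrightarrow> x \<le> l \<Longrightarrow> R x = None"
  shows "fill_row k R l = Some (v, k)"
  using assms(2,3)
proof (induction l)
  case (Suc l)
  have "R (Suc l) = None" using Suc.prems by simp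
  moreover have "map_option (\<lambda>(v, _). (v, k)) (fill_row k R l) = Some (v, k)"
  proof (cases "a = l")
    case True
    then show ?thesis using fill_row_Some[of R l "(v, d)" k] assms(1) by simp
  next
    case False
    then have "fill_row k R l = Some (v, k)" using Suc by simp
    then show ?thesis by simp
  qed
  ultimately show ?case by simp
qed simp

text \<open>The entries up to \<open>x\<close> form the top of an increasing column, so one
  comparison in row \<open>s\<close> bounds their number. In the second part
  \<open>s = Suc k\<close> stands for the place below the last row.\<close>

lemma card_column:
  fixes f :: "nat \<Rightarrow> nat"
  assumes inc: "\<And>s s'. 1 \<le> s \<Longrightarrow> s < s' \<Longrightarrow> s' \<le> k \<Longrightarrow> f s < f s'"
  shows "s \<in> {1..k} \<Longrightarrow> f s \<le> x \<Longrightarrow> s \<le> card {s \<in> {1..k}. f s \<le> x}"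
    and "s \<in> {1..Suc k} \<Longrightarrow> (s \<le> k \<Longrightarrow> x < f s) \<Longrightarrow> card {s \<in> {1..k}. f s \<le> x} \<le> s - 1"
proof -
  assume s: "s \<in> {1..k}" "f s \<le> x"
  have "{1..s} \<subseteq> {s \<in> {1..k}. f s \<le> x}"
  proof
    fix a assume a: "a \<in> {1..s}"
    then have "f a \<le> f s" using inc[of a s] s by (cases "a = s") auto
    then show "a \<in> {s \<in> {1..k}. f s \<le> x}" using a s by simp
  qed
  then have "card {1..s} \<le> card {s \<in> {1..k}. f s \<le> x}" by (rule card_mono[rotated]) simp
  then show "s \<le> card {s \<in> {1..k}. f s \<le> x}" by simp
next
  assume s: "s \<in> {1..Suc k}" "s \<le> k \<Longrightarrow> x < f s"
  have "{s \<in> {1..k}. f s \<le> x} \<subseteq> {1..s - 1}"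
  proof
    fix a assume a: "a \<in> {s \<in> {1..k}. f s \<le> x}"
    have "a < s"
    proof (rule ccontr)
      assume "\<not> a < s"
      then have "s \<le> k" using a by simp
      have "f s \<le> f a"
      proof (cases "a = s")
        case False
        then show ?thesis using inc[of s a] \<open>\<not> a < s\<close> a s(1) by simp
      qed simp
      then show False using a s(2)[OF \<open>s \<le> k\<close>] by simp
    qed
    then show "a \<in> {1..s - 1}" using a by simp
  qed
  then have "card {s \<in> {1..k}. f s \<le> x} \<le> card {1..s - 1}" by (rule card_mono[rotated]) simp
  then show "card {s \<in> {1..k}. f s \<le> x} \<le> s - 1" by simp
qed

context semistandard
begin

lemma tableau_config_eq:
  "tableau_config S q l = (if q \<in> {1..p} \<and> l \<in> {1..row_length q} then Some (entry q l) else None)"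
  by (simp add: tableau_config_def num_rows_def p_def row_length_def entry_def)

lemma tableau_config_outside: "l \<notin> {1..c} \<Longrightarrow> tableau_config S q l = None"
  using row_length_le[of q] by (auto simp: tableau_config_eq)

lemma row_coloured_eq:
  "row_coloured (tableau_config S) q l =
     (if q \<in> {1..p} \<and> l \<in> {1..row_length q} then Some (entry q l, q) else None)"
  by (simp add: row_coloured_def tableau_config_eq)

end

text \<open>\<open>V\<close> is the array of values of the filled configuration after step \<open>k\<close>: its first \<open>k\<close> rows are a
  semistandard rectangle, and the unfilled configuration is \<open>V\<close> with repeated entries erased.\<close>

locale filled = semistandard +
  fixes k :: nat and V :: "nat \<Rightarrow> nat \<Rightarrow> nat"
  assumes k: "1 \<le> k" "k \<le> p"
    and coloured_V: "q \<in> {1..k} \<Longrightarrow> l \<in> {1..c} \<Longrightarrow> \<exists>d. coloured S k q l = Some (V q l, d)"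
    and outside: "l \<notin> {1..c} \<Longrightarrow> pushed S k q l = None" "l \<notin> {1..c} \<Longrightarrow> coloured S k q l = None"
    and row_0: "pushed S k 0 l = None" "coloured S k 0 l = None"
    and below: "k < q \<Longrightarrow> pushed S k q l = tableau_config S q l"
      "k < q \<Longrightarrow> coloured S k q l = row_coloured (tableau_config S) q l"
    and reads: "reads c k (pushed S k) V"
    and rows: "q \<in> {1..k} \<Longrightarrow> 1 \<le> l \<Longrightarrow> l \<le> l' \<Longrightarrow> l' \<le> c \<Longrightarrow> V q l \<le> V q l'"
    and cols: "1 \<le> q \<Longrightarrow> q < k \<Longrightarrow> l \<in> {1..c} \<Longrightarrow> V q l < V (Suc q) l"
    and V_pos: "q \<in> {1..k} \<Longrightarrow> l \<in> {1..c} \<Longrightarrow> 1 \<le> V q l"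
    and V_entry: "q \<in> {1..k} \<Longrightarrow> l \<in> {1..row_length k} \<Longrightarrow> V q l = entry q l"
    and colours: "l \<in> {1..c} \<Longrightarrow> d \<in> {1..k} \<Longrightarrow> \<exists>q \<in> {1..k}. coloured S k q l = Some (chain l d, d)"
begin

lemma cols_less:
  assumes "1 \<le> q" "q < q'" "q' \<le> k" "l \<in> {1..c}"
  shows "V q l < V q' l"
proof -
  have "Suc q \<le> q'" using assms(2) by simp
  then show ?thesis using assms(3)
  proof (induction q' rule: dec_induct)
    case base
    then show ?case using assms by (simp add: cols)
  next
    case (step q')
    then have "V q' l < V (Suc q') l" using assms by (intro cols) auto
    then show ?case using step by simp
  qed
qed

text \<open>A box has only one colour, so the \<open>k\<close> colours need \<open>k\<close>
  different rows, and there are just \<open>k\<close> of them.\<close>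

lemma colour_rows:
  assumes l: "l \<in> {1..c}"
  obtains R where "bij_betw R {1..k} {1..k}"
    "\<And>d. d \<in> {1..k} \<Longrightarrow> coloured S k (R d) l = Some (chain l d, d)"
proof -
  obtain R where R: "\<And>d. d \<in> {1..k} \<Longrightarrow> R d \<in> {1..k} \<and> coloured S k (R d) l = Some (chain l d, d)"
    using colours[OF l] by metis
  have "inj_on R {1..k}"
  proof (rule inj_onI)
    fix d d' assume "d \<in> {1..k}" "d' \<in> {1..k}" "R d = R d'"
    then have "Some (chain l d, d) = Some (chain l d', d')" using R by metis
    then show "d = d'" by simp
  qed
  moreover have "R ` {1..k} \<subseteq> {1..k}" using R by blast
  ultimately have "bij_betw R {1..k} {1..k}" by (simp add: bij_betw_def endo_inj_surj)
  then show thesis using R by (intro that[of R]) blast+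
qed

text \<open>Counts ignore order, so the first \<open>k\<close> chain entries may be replaced by the
  column of \<open>V\<close>, which increases downwards. This is the link between Bruhat order and
  configurations.\<close>

lemma cnt_chain:
  assumes l: "l \<in> {1..c}"
  shows "cnt (chain l) k x = card {q \<in> {1..k}. V q l \<le> x}"
proof -
  obtain R where R: "bij_betw R {1..k} {1..k}"
    "\<And>d. d \<in> {1..k} \<Longrightarrow> coloured S k (R d) l = Some (chain l d, d)"
    using colour_rows[OF l] by metis
  have V: "V (R d) l = chain l d" if "d \<in> {1..k}" for d
  proof -
    have "R d \<in> {1..k}" using R(1) that by (rule bij_betwE[rule_format])
    then show ?thesis using coloured_V[OF _ l, of "R d"] R(2)[OF that] by auto
  qed
  have "R ` {d \<in> {1..k}. chain l d \<le> x} = {q \<in> {1..k}. V q l \<le> x}"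
  proof -
    have "{q \<in> {1..k}. V q l \<le> x} = {q \<in> R ` {1..k}. V q l \<le> x}" by (simp only: bij_betw_imp_surj_on[OF R(1)])
    also have "\<dots> = R ` {d \<in> {1..k}. V (R d) l \<le> x}" by blast
    also have "{d \<in> {1..k}. V (R d) l \<le> x} = {d \<in> {1..k}. chain l d \<le> x}"
      by (rule Collect_cong) (use V in auto)
    finally show ?thesis by simp
  qed
  moreover have "inj_on R {d \<in> {1..k}. chain l d \<le> x}"
    by (rule inj_on_subset[OF bij_betw_imp_inj_on[OF R(1)]]) auto
  ultimately show ?thesis unfolding cnt_def using card_image[of R "{d \<in> {1..k}. chain l d \<le> x}"] by simp
qed

end

section \<open>Passing from \<open>k\<close> to \<open>Suc k\<close> rows\<close>

locale push_step = filled +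
  fixes m e :: "nat \<Rightarrow> nat"
  assumes Suc_k: "Suc k \<le> p"
    and cuts: "cuts c k V m e"
    and m_Suc_k: "m (Suc k) = row_length (Suc k) + 1"
    and e_Suc_k: "e (Suc k) = entry (Suc k) (row_length (Suc k))"
begin

lemma row_length_Suc_k: "1 \<le> row_length (Suc k)" "row_length (Suc k) \<le> c" "row_length (Suc k) \<le> row_length k"
  using row_length_pos[of "Suc k"] row_length_le[of "Suc k"] row_length_antimono[of k "Suc k"] Suc_k k by auto

lemma m_antimono: "a \<le> b \<Longrightarrow> b \<le> Suc k \<Longrightarrow> m b \<le> m a"
  using cuts_antimono[OF cuts] by blast

lemma m_bounds: "q \<le> Suc k \<Longrightarrow> 2 \<le> m q" "q \<le> Suc k \<Longrightarrow> m q \<le> c + 1" "m 0 = c + 1"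
  by (simp_all add: cuts_bounds[OF cuts] cutsD(1)[OF cuts] del: One_nat_def)

lemma e_eq: "q \<in> {1..k} \<Longrightarrow> e q = V q (m q - 1)"
  by (rule cutsD(2)[OF cuts])

lemma less_m_iff: "q \<in> {1..k} \<Longrightarrow> l \<in> {1..c} \<Longrightarrow> l < m q \<longleftrightarrow> V q l < e (Suc q)"
  by (rule cutsD(3)[OF cuts])

text \<open>The array before the pushes with row \<open>Suc k\<close> of \<open>S\<close> put below
  it; that row is meaningful only up to its length.\<close>

definition "V0 q l = (if q = Suc k then entry q l else V q l)"

text \<open>The middle case is the gap between the part of row \<open>q\<close> that stays and the
  part received from row \<open>q - 1\<close>; filling puts copies of \<open>e q\<close>
  there.\<close>

definition "V' q l = (if l < m q then V0 q l else if l < m (q - 1) then e q else V0 (q - 1) l)"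

lemma e_V0: "q \<in> {1..Suc k} \<Longrightarrow> e q = V0 q (m q - 1)"
  using e_eq[of q] m_Suc_k e_Suc_k by (cases "q = Suc k") (auto simp: V0_def)

lemma e_less: "q \<in> {1..k} \<Longrightarrow> e q < e (Suc q)"
proof -
  assume q: "q \<in> {1..k}"
  then have "m q - 1 \<in> {1..c}" "m q - 1 < m q" using m_bounds(1,2)[of q] by auto
  then show ?thesis using less_m_iff[OF q] e_eq[OF q] by metis
qed

lemma e_mono:
  assumes "1 \<le> q" "q \<le> q'" "q' \<le> Suc k"
  shows "e q \<le> e q'"
  using assms(2,3)
proof (induction q' rule: dec_induct)
  case (step q')
  then have "e q' < e (Suc q')" using assms(1) by (intro e_less) auto
  then show ?case using step by simp
qed simp

text \<open>Row \<open>Suc k\<close> ends just before its nominal cut \<open>m (Suc k)\<close>, so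
  declaring it empty from there on changes nothing, and all rows obey one formula.\<close>

lemma fold_eq:
  assumes "l \<in> {1..c}" "\<And>x. U 0 x = None" "\<And>x. row_length (Suc k) < x \<Longrightarrow> U (Suc k) x = None"
  shows "fold shift_down (row_pushes (pushed S k) (Suc k)) U q l =
    (if q \<in> {1..Suc k} then if m (q - 1) \<le> l then U (q - 1) l else if m q \<le> l then None else U q l
     else U q l)"
proof -
  let ?j = "row_length (Suc k)"
  have row: "pushed S k (Suc k) x = (if x \<in> {1..?j} then Some (entry (Suc k) x) else None)" for x
    using below(1)[of "Suc k"] Suc_k by (simp add: tableau_config_eq)
  have "{x. pushed S k (Suc k) x \<noteq> None} = {1..?j}" by (auto simp: row split: if_splits)
  moreover have "Max {1..?j} = ?j" by (rule Max_eqI) (use row_length_Suc_k(1) in auto)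
  ultimately have "Max {x. pushed S k (Suc k) x \<noteq> None} = ?j" by (simp only:)
  then have "row_pushes (pushed S k) (Suc k) = pushes (pushed S k) (Suc k) ?j" by (simp only: row_pushes_def)
  moreover have "the (pushed S k (Suc k) ?j) = e (Suc k)" using row[of ?j] row_length_Suc_k(1) e_Suc_k by simp
  ultimately have "fold shift_down (row_pushes (pushed S k) (Suc k)) U q l =
    (if 1 \<le> q \<and> q \<le> Suc k \<and> m (q - 1) \<le> l then U (q - 1) l
     else if q \<le> k \<and> m q \<le> l then None else U q l)"
    using fold_pushes[OF reads cuts _ assms(1), of ?j U q] by simp
  moreover have "U (Suc k) l = None" if "m (Suc k) \<le> l" using that m_Suc_k by (intro assms(3)) simp
  moreover have "\<not> m 0 \<le> l" using assms(1) m_bounds(3) by simp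
  ultimately show ?thesis
    by (cases "q = 0"; cases "q = Suc k") (auto simp: le_Suc_eq)
qed

lemma pushed_Suc: "pushed S (Suc k) = fold shift_down (row_pushes (pushed S k) (Suc k)) (pushed S k)"
  using k(1) by (cases k) auto

lemma pushed_eq:
  assumes "l \<in> {1..c}"
  shows "pushed S (Suc k) q l =
    (if q \<in> {1..Suc k} then if m (q - 1) \<le> l then pushed S k (q - 1) l
       else if m q \<le> l then None else pushed S k q l
     else pushed S k q l)"
  unfolding pushed_Suc
  by (rule fold_eq[OF assms]) (auto simp: row_0 below tableau_config_eq)

lemma coloured_Suc:
  "coloured S (Suc k) = fill c (Suc k) (fold shift_down (row_pushes (pushed S k) (Suc k)) (coloured S k))"
  using k(1) by (cases k) (auto simp: c_def)

lemma coloured_cut: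
  assumes "q \<in> {1..Suc k}"
  shows "\<exists>d. coloured S k q (m q - 1) = Some (e q, d)"
proof (cases "q = Suc k")
  case True
  then show ?thesis
    using below(2)[of "Suc k"] Suc_k row_length_Suc_k m_Suc_k e_Suc_k by (simp add: row_coloured_eq)
next
  case False
  then have "q \<in> {1..k}" "m q - 1 \<in> {1..c}" using assms m_bounds(1,2)[of q] by auto
  then show ?thesis using coloured_V e_eq by simp
qed

lemma coloured_kept:
  assumes "q \<in> {1..Suc k}" "l \<in> {1..c}" "l < m q"
  shows "\<exists>d. coloured S k q l = Some (V0 q l, d)"
proof (cases "q = Suc k")
  case True
  then show ?thesis
    using below(2)[of "Suc k"] Suc_k m_Suc_k assms by (simp add: row_coloured_eq V0_def)
next
  case False
  then have "q \<in> {1..k}" using assms by auto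
  then show ?thesis using coloured_V assms(2) False by (simp add: V0_def)
qed

lemma coloured_eq:
  assumes l: "l \<in> {1..c}"
  shows "coloured S (Suc k) q l =
    (if q \<in> {1..Suc k} then if m (q - 1) \<le> l then coloured S k (q - 1) l
       else if m q \<le> l then Some (e q, Suc k) else coloured S k q l
     else coloured S k q l)"
proof -
  define U where "U = fold shift_down (row_pushes (pushed S k) (Suc k)) (coloured S k)"
  have U: "U q x = (if q \<in> {1..Suc k} then if m (q - 1) \<le> x then coloured S k (q - 1) x
       else if m q \<le> x then None else coloured S k q x
     else coloured S k q x)" if "x \<in> {1..c}" for q x
    unfolding U_def by (rule fold_eq[OF that]) (auto simp: row_0 below row_coloured_eq)
  have C: "coloured S (Suc k) q l = (if q \<in> {1..Suc k} then fill_row (Suc k) (U q) l else U q l)"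
    unfolding coloured_Suc U_def[symmetric] fill_def using l by simp
  show ?thesis
  proof (cases "q \<in> {1..Suc k}")
    case False
    show ?thesis using C U[OF l, of q] by (simp only: False if_False)
  next
    case q: True
    consider (moved) "m (q - 1) \<le> l" | (new) "l < m (q - 1)" "m q \<le> l" | (kept) "l < m (q - 1)" "l < m q"
      by linarith
    then show ?thesis
    proof cases
      case moved
      then have "q \<noteq> 1" using l m_bounds(3) by auto
      then have "q - 1 \<in> {1..k}" using q by auto
      then obtain d where "coloured S k (q - 1) l = Some (V (q - 1) l, d)" using coloured_V[OF _ l] by blast
      then show ?thesis using C U[OF l, of q] q moved fill_row_Some[of "U q" l _ "Suc k"] by simp
    next
      case new
      \<comment> \<open>Filling starts from a nonempty box: column \<open>m q - 1\<close> is
        retained and carries \<open>e q\<close>, and from there to \<open>l\<close> everything is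
        empty after the shifts.\<close>
      have mq: "2 \<le> m q" using q m_bounds(1)[of q] by simp
      obtain d where "coloured S k q (m q - 1) = Some (e q, d)" using coloured_cut[OF q] by blast
      moreover have "m q - 1 \<in> {1..c}" using mq new l by auto
      moreover have "\<not> m (q - 1) \<le> m q - 1" "\<not> m q \<le> m q - 1" using new mq by linarith+
      ultimately have "U q (m q - 1) = Some (e q, d)" using U[of "m q - 1" q] q by (simp only: if_True if_False)
      moreover have "U q x = None" if x: "m q - 1 < x" "x \<le> l" for x
      proof -
        have "\<not> m (q - 1) \<le> x" "m q \<le> x" "x \<in> {1..c}" using x new mq l by auto
        then show ?thesis using U[of x q] q by (simp only: if_True if_False)
      qed
      moreover have "m q - 1 < l" using new mq by simp
      ultimately have "fill_row (Suc k) (U q) l = Some (e q, Suc k)"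
        using fill_row_None[of "U q" "m q - 1" "e q" d l] by blast
      then show ?thesis using C q new by simp
    next
      case kept
      obtain d where "coloured S k q l = Some (V0 q l, d)" using coloured_kept[OF q l kept(2)] by blast
      then show ?thesis using C U[OF l, of q] q kept fill_row_Some[of "U q" l _ "Suc k"] by simp
    qed
  qed
qed

text \<open>The intervals \<open>[m q, m (q - 1))\<close>, for \<open>q\<close> from
  \<open>Suc k\<close> down to 1, tile the columns after the end of row \<open>Suc k\<close>, that
  is from \<open>m (Suc k)\<close> to \<open>m 0 - 1 = c\<close>.\<close>

lemma new_row_exists:
  assumes "row_length (Suc k) < l" "l \<le> c"
  obtains q where "q \<in> {1..Suc k}" "m q \<le> l" "l < m (q - 1)"
proof -
  define q where "q = (LEAST q. m q \<le> l)"
  have ex: "m (Suc k) \<le> l" using assms m_Suc_k by simp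
  have q: "m q \<le> l" unfolding q_def by (rule LeastI[where P = "\<lambda>q. m q \<le> l", OF ex])
  have "q \<le> Suc k" unfolding q_def by (rule Least_le[where P = "\<lambda>q. m q \<le> l", OF ex])
  moreover have "q \<noteq> 0" using q assms m_bounds(3) by (cases "q = 0") auto
  moreover have "\<not> m (q - 1) \<le> l"
    using not_less_Least[of "q - 1" "\<lambda>q. m q \<le> l"] \<open>q \<noteq> 0\<close> by (simp add: q_def)
  ultimately show thesis using q by (intro that[of q]) simp_all
qed

text \<open>If the entries of colour \<open>Suc k\<close> in columns \<open>l - 1\<close> and \<open>l\<close> lie in rows \<open>q'\<close> and \<open>q\<close>, every row \<open>s\<close> with
  \<open>q \<le> s < q'\<close> is cut at \<open>m s = l\<close>. So \<open>V s (l - 1) = e s\<close> and \<open>e (Suc s) \<le> V s l\<close>, and the counts of the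
  two columns differ throughout \<open>[e q, e q')\<close>.\<close>

lemma greedy_new_entry:
  assumes l: "row_length (Suc k) < l" "l \<le> c"
    and q: "q \<in> {1..Suc k}" "m q \<le> l" "l < m (q - 1)"
    and q': "q' \<in> {1..Suc k}" "l \<le> m (q' - 1)" "q \<le> q'" "chain (l - 1) (Suc k) = e q'"
  shows "greedy_step (chain (l - 1)) (chain l) k (e q)"
proof -
  have lc: "l \<in> {1..c}" "l - 1 \<in> {1..c}" using l row_length_Suc_k by auto
  note count = cnt_chain[OF lc(1)] cnt_chain[OF lc(2)]
  have inc: "V s x < V s' x" if "1 \<le> s" "s < s'" "s' \<le> k" "x \<in> {1..c}" for s s' x
    by (rule cols_less) (use that in auto)
  have E: "e q \<le> V q (l - 1)" "e q \<le> V q l" if "q \<le> k"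
  proof -
    have "q \<in> {1..k}" using that q by simp
    moreover have "1 \<le> m q - 1" using m_bounds(1)[of q] q by simp
    ultimately show "e q \<le> V q (l - 1)" "e q \<le> V q l"
      using e_eq[of q] q lc by (auto intro!: rows)
  qed
  have pos: "1 \<le> e q"
  proof (cases "q = Suc k")
    case True
    then show ?thesis
      using entry_range[of "Suc k" "row_length (Suc k)"] e_Suc_k row_length_Suc_k Suc_k by simp
  next
    case False
    then have "q \<in> {1..k}" "m q - 1 \<in> {1..c}" using q m_bounds(1,2)[of q] by auto
    then show ?thesis using V_pos e_eq by simp
  qed
  \<comment> \<open>In both columns the rows before \<open>q\<close> hold values less than
    \<open>e q\<close>, since \<open>l < m (q - 1)\<close>, and the rows from \<open>q\<close> on
    hold values at least \<open>e q\<close>.\<close>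
  have level: "card {s \<in> {1..k}. V s x \<le> e q - 1} = q - 1" if x: "x = l \<or> x = l - 1" for x
  proof (rule antisym)
    have xc: "x \<in> {1..c}" using x lc by auto
    have up: "e q - 1 < V q x" if "q \<le> k" using E[OF that] x pos by auto
    show "card {s \<in> {1..k}. V s x \<le> e q - 1} \<le> q - 1"
      by (rule card_column(2)) (use inc[OF _ _ _ xc] q(1) up in auto)
    show "q - 1 \<le> card {s \<in> {1..k}. V s x \<le> e q - 1}"
    proof (cases "q = 1")
      case False
      then have q1: "q - 1 \<in> {1..k}" using q by auto
      then have "V (q - 1) l < e (Suc (q - 1))" using less_m_iff[OF q1 lc(1)] q(3) by simp
      moreover have "V (q - 1) x \<le> V (q - 1) l" using q1 x lc by (auto intro!: rows)
      ultimately have "V (q - 1) x \<le> e q - 1" using False q by simp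
      then show ?thesis using q1 inc[OF _ _ _ xc] by (intro card_column(1)) auto
    qed simp
  qed
  have strict: "card {s \<in> {1..k}. V s l \<le> x} < card {s \<in> {1..k}. V s (l - 1) \<le> x}"
    if x: "e q \<le> x" "x < e q'" for x
  proof -
    \<comment> \<open>The thresholds from \<open>e q\<close> to \<open>e q'\<close> increase, so
      \<open>x\<close> falls between two neighbours \<open>e s\<close> and \<open>e (Suc s)\<close>;
      \<open>s\<close> is found as a maximum.\<close>
    define A where "A = {s. s < q' \<and> q \<le> s \<and> e s \<le> x}"
    have fin: "finite A" by (rule finite_subset[of _ "{..<q'}"]) (auto simp: A_def)
    have "q \<noteq> q'" using x by auto
    then have "q \<in> A" using q'(3) x by (simp add: A_def)
    then have "Max A \<in> A" using Max_in[OF fin] by blast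
    define s where "s = Max A"
    have s: "s < q'" "q \<le> s" "e s \<le> x" using \<open>Max A \<in> A\<close> by (simp_all add: s_def A_def)
    have next_s: "x < e (Suc s)"
    proof (rule ccontr)
      assume "\<not> x < e (Suc s)"
      then have "Suc s \<noteq> q'" using x by auto
      then have "Suc s \<in> A" using s \<open>\<not> x < e (Suc s)\<close> by (simp add: A_def)
      then have "Suc s \<le> s" unfolding s_def by (rule Max_ge[OF fin])
      then show False by simp
    qed
    have sk: "s \<in> {1..k}" using s q q' by auto
    have "m s \<le> m q" using s sk by (intro m_antimono) auto
    moreover have "m (q' - 1) \<le> m s" using s sk q' by (intro m_antimono) auto
    ultimately have "m s = l" using q q' by simp
    then have "V s (l - 1) \<le> x" "x < V s l"
      using s next_s e_eq[OF sk] less_m_iff[OF sk lc(1)] by auto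
    have "s \<le> card {s \<in> {1..k}. V s (l - 1) \<le> x}"
      by (rule card_column(1)) (use inc[OF _ _ _ lc(2)] sk \<open>V s (l - 1) \<le> x\<close> in auto)
    moreover have "card {s \<in> {1..k}. V s l \<le> x} \<le> s - 1"
      by (rule card_column(2)) (use inc[OF _ _ _ lc(1)] sk \<open>x < V s l\<close> in auto)
    moreover have "1 \<le> s" using sk by simp
    ultimately show ?thesis by linarith
  qed
  have "e q \<le> e q'" using q q' by (intro e_mono) auto
  then show ?thesis
    unfolding greedy_step_def count q'(4) using pos level[of l] level[of "l - 1"] strict by simp
qed

text \<open>Induction along the columns beyond row \<open>Suc k\<close>. The chain and the array
  both make a greedy step from the same previous entry, so uniqueness identifies the
  results.\<close>

lemma new_entry:
  assumes "row_length (Suc k) < l" "l \<le> c" "q \<in> {1..Suc k}" "m q \<le> l" "l < m (q - 1)"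
  shows "chain l (Suc k) = e q"
proof -
  have "Suc (row_length (Suc k)) \<le> l" using assms(1) by simp
  then show ?thesis using assms(2-5)
  proof (induction l arbitrary: q rule: dec_induct)
    case base
    let ?l = "Suc (row_length (Suc k))"
    have "greedy_step (chain (?l - 1)) (chain ?l) k (e q)"
    proof (rule greedy_new_entry)
      \<comment> \<open>The last entry of row \<open>Suc k\<close> plays the role of the previous
        new entry, with \<open>q' = Suc k\<close>.\<close>
      show "chain (?l - 1) (Suc k) = e (Suc k)"
        using chain_entry[of "Suc k" "row_length (Suc k)"] Suc_k row_length_Suc_k e_Suc_k by simp
      show "?l \<le> m (Suc k - 1)" using m_antimono[of k "Suc k"] m_Suc_k by simp
    qed (use base in auto)
    moreover have "greedy_step (chain (?l - 1)) (chain ?l) k (chain ?l (Suc k))"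
      using chain_greedy[of "Suc k" "row_length (Suc k)"] Suc_k row_length_Suc_k by simp
    ultimately show ?case by (rule greedy_step_unique[rotated])
  next
    case (step l)
    obtain q' where q': "q' \<in> {1..Suc k}" "m q' \<le> l" "l < m (q' - 1)"
      using new_row_exists[of l] step.hyps step.prems(1) by auto
    have "greedy_step (chain (Suc l - 1)) (chain (Suc l)) k (e q)"
    proof (rule greedy_new_entry)
      show "chain (Suc l - 1) (Suc k) = e q'" using step.IH[of q'] q' step.prems(1) by simp
      show "q' \<in> {1..Suc k}" by fact
      show "Suc l \<le> m (q' - 1)" using q' by simp
      show "q \<le> q'"
      proof (rule ccontr)
        assume "\<not> q \<le> q'"
        then have "m (q - 1) \<le> m q'" using step.prems q' by (intro m_antimono) auto
        then show False using step.prems q' by simp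
      qed
    qed (use step in auto)
    moreover have "greedy_step (chain (Suc l - 1)) (chain (Suc l)) k (chain (Suc l) (Suc k))"
      using chain_greedy[of "Suc k" l] Suc_k row_length_Suc_k step.hyps by simp
    ultimately show ?case by (rule greedy_step_unique[rotated])
  qed
qed

section \<open>The new array is again a semistandard rectangle\<close>

lemma V'_cases:
  assumes "q \<in> {1..Suc k}" "l \<in> {1..c}"
  obtains (kept) "l < m q" "l < m (q - 1)" "V' q l = V0 q l"
  | (new) "m q \<le> l" "l < m (q - 1)" "V' q l = e q"
  | (moved) "m q \<le> l" "m (q - 1) \<le> l" "V' q l = V (q - 1) l" "q - 1 \<in> {1..k}"
proof -
  have le: "m q \<le> m (q - 1)" using assms by (intro m_antimono) auto
  consider "l < m q" | "m q \<le> l" "l < m (q - 1)" | "m (q - 1) \<le> l" by linarith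
  then show thesis
  proof cases
    case 3
    then have "q \<noteq> 1" using m_bounds(3) assms(2) by auto
    then have "q - 1 \<in> {1..k}" "q - 1 \<noteq> Suc k" using assms(1) by auto
    then show thesis using 3 le by (intro moved) (auto simp: V'_def V0_def)
  qed (use le kept new in \<open>auto simp: V'_def\<close>)
qed

lemma V0_mono:
  assumes "q \<in> {1..Suc k}" "1 \<le> l" "l \<le> l'" "l' < m q"
  shows "V0 q l \<le> V0 q l'"
proof (cases "q = Suc k")
  case True
  then show ?thesis using assms Suc_k m_Suc_k by (auto simp: V0_def intro!: entry_row_mono)
next
  case False
  then show ?thesis using assms m_bounds(2)[of q] by (auto simp: V0_def intro!: rows)
qed

text \<open>The three blocks of a row join without descent: the part that stays ends in
  \<open>e q\<close>, the gap repeats it, and what arrives from row \<open>q - 1\<close> begins at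
  its cut, where values have reached \<open>e q\<close>.\<close>

lemma rows':
  assumes q: "q \<in> {1..Suc k}" and l: "1 \<le> l" "Suc l \<le> c"
  shows "V' q l \<le> V' q (Suc l)"
proof -
  have le: "m q \<le> m (q - 1)" using q by (intro m_antimono) auto
  have lc: "l \<in> {1..c}" "Suc l \<in> {1..c}" using l by auto
  show ?thesis
    using q lc(1)
  proof (cases rule: V'_cases)
    case kept
    show ?thesis
      using q lc(2)
    proof (cases rule: V'_cases)
      case kept': kept
      then show ?thesis using kept V0_mono[OF q l(1), of "Suc l"] by simp
    next
      case new
      then have "m q = Suc l" using kept by simp
      then have "e q = V0 q l" using e_V0[OF q] by simp
      then show ?thesis using kept new by simp
    next
      case moved
      then have m: "m q = Suc l" "m (q - 1) = Suc l" using kept le by simp_all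
      have "\<not> V (q - 1) (Suc l) < e (Suc (q - 1))" using less_m_iff[OF moved(4) lc(2)] m by simp
      moreover have "e q = V0 q l" using e_V0[OF q] m by simp
      ultimately show ?thesis using q kept moved by simp
    qed
  next
    case new
    show ?thesis
      using q lc(2)
    proof (cases rule: V'_cases)
      case moved
      have "\<not> V (q - 1) (Suc l) < e (Suc (q - 1))" using less_m_iff[OF moved(4) lc(2)] moved by simp
      then show ?thesis using q new moved by simp
    qed (use new in auto)
  next
    case moved
    show ?thesis
      using q lc(2)
    proof (cases rule: V'_cases)
      case moved': moved
      then show ?thesis using moved l by (auto intro!: rows)
    qed (use moved in auto)
  qed
qed

text \<open>In a column, \<open>e (Suc q)\<close> exceeds what row \<open>q\<close> retains and is
  at most what row \<open>q\<close> hands down; with \<open>e q < e (Suc q)\<close> this settles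
  every case not inherited from \<open>V\<close> or \<open>S\<close>.\<close>

lemma cols':
  assumes q: "1 \<le> q" "q < Suc k" and l: "l \<in> {1..c}"
  shows "V' q l < V' (Suc q) l"
proof -
  have qk: "q \<in> {1..k}" "q \<in> {1..Suc k}" "Suc q \<in> {1..Suc k}" using q by auto
  have le: "m (Suc q) \<le> m q" using q by (intro m_antimono) auto
  have le': "m q \<le> m (q - 1)" using q by (intro m_antimono) auto
  show ?thesis
    using qk(3) l
  proof (cases rule: V'_cases)
    case kept
    then have "l < m q" by simp
    then have V'q: "V' q l = V q l" using q by (simp add: V'_def V0_def)
    show ?thesis
    proof (cases "q = k")
      case True
      \<comment> \<open>Row \<open>Suc k\<close> comes from \<open>S\<close>, and in its columns row
        \<open>k\<close> still agrees with \<open>S\<close>, so the strictness of \<open>S\<close>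
        applies.\<close>
      have "l \<le> row_length (Suc k)" using kept(1) True m_Suc_k by simp
      then have "V k l = entry k l" using V_entry[of k l] k l row_length_Suc_k by simp
      moreover have "entry k l < entry (Suc k) l"
        using l k Suc_k \<open>l \<le> row_length (Suc k)\<close> by (intro entry_col_mono) auto
      ultimately show ?thesis using V'q kept(3) True by (simp add: V0_def)
    next
      case False
      then show ?thesis using V'q kept(3) cols[of q l] q l by (simp add: V0_def)
    qed
  next
    case new
    then have "V' q l = V q l" using q by (simp add: V'_def V0_def)
    moreover have "V q l < e (Suc q)" using less_m_iff[OF qk(1) l] new by simp
    ultimately show ?thesis using new by simp
  next
    case moved
    then have V'S: "V' (Suc q) l = V q l" "m q \<le> l" by simp_all
    show ?thesis
      using qk(2) l
    proof (cases rule: V'_cases)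
      case new
      have "\<not> V q l < e (Suc q)" using less_m_iff[OF qk(1) l] V'S by simp
      then show ?thesis using new V'S e_less[OF qk(1)] by simp
    next
      case moved': moved
      then have "V (q - 1) l < V (Suc (q - 1)) l" using q l by (intro cols) auto
      then show ?thesis using moved' V'S q by simp
    qed (use V'S in simp)
  qed
qed

lemma reads_Suc: "reads c (Suc k) (pushed S (Suc k)) V'"
proof -
  have old: "pushed S k q 1 \<noteq> None"
    "case pushed S k q l of Some y \<Rightarrow> l \<in> {1..c} \<and> y = V q l
      | None \<Rightarrow> l \<in> {2..c} \<longrightarrow> V q l = V q (l - 1)" if "q \<in> {1..k}" for q l
    using reads that unfolding reads_def by blast+
  have top: "pushed S k (Suc k) l = (if l \<in> {1..row_length (Suc k)} then Some (entry (Suc k) l) else None)" for l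
    using below(1)[of "Suc k" l] Suc_k by (simp add: tableau_config_eq)
  have kept_old: "case pushed S k q l of Some y \<Rightarrow> l \<in> {1..c} \<and> y = V0 q l
      | None \<Rightarrow> l \<in> {2..c} \<longrightarrow> V0 q l = V0 q (l - 1)" if "q \<in> {1..Suc k}" "l \<in> {1..c}" "l < m q" for q l
  proof (cases "q = Suc k")
    case True
    then show ?thesis using that top[of l] m_Suc_k by (simp add: V0_def)
  next
    case False
    then have V0_eq: "V0 q x = V q x" for x by (simp add: V0_def)
    have "q \<in> {1..k}" using that False by auto
    then show ?thesis unfolding V0_eq by (rule old(2))
  qed
  show ?thesis
    unfolding reads_def
  proof (intro conjI allI ballI)
    show "pushed S (Suc k) 0 l = None" for l
    proof (cases "l \<in> {1..c}")
      case True
      then show ?thesis by (simp add: pushed_eq row_0)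
    next
      case False
      then show ?thesis unfolding pushed_Suc by (intro fold_shift_down_None outside)
    qed
  next
    fix q assume q: "q \<in> {1..Suc k}"
    \<comment> \<open>Cuts are at least 2, so column 1 never moves.\<close>
    have "q \<le> Suc k" "q - 1 \<le> Suc k" using q by auto
    then have "1 < m q" "1 < m (q - 1)" using m_bounds(1)[of q] m_bounds(1)[of "q - 1"] by linarith+
    then have "pushed S (Suc k) q 1 = pushed S k q 1" using pushed_eq[of 1 q] c_pos q by simp
    also have "\<dots> \<noteq> None"
      using old(1)[of q] top[of 1] row_length_Suc_k(1) q by (cases "q = Suc k") auto
    finally show "pushed S (Suc k) q 1 \<noteq> None" .
    fix l
    show "case pushed S (Suc k) q l of Some y \<Rightarrow> l \<in> {1..c} \<and> y = V' q l
      | None \<Rightarrow> l \<in> {2..c} \<longrightarrow> V' q l = V' q (l - 1)"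
    proof (cases "l \<in> {1..c}")
      case False
      then have "pushed S (Suc k) q l = None"
        unfolding pushed_Suc by (intro fold_shift_down_None outside)
      then show ?thesis using False by auto
    next
      case l: True
      show ?thesis
        using q l
      proof (cases rule: V'_cases)
        case kept
        then have p: "pushed S (Suc k) q l = pushed S k q l" using pushed_eq[OF l, of q] q by simp
        have "l - 1 < m q" using kept(1) by linarith
        then have V'_pred: "V' q (l - 1) = V0 q (l - 1)" by (simp only: V'_def if_True)
        show ?thesis unfolding p V'_pred kept(3) by (rule kept_old[OF q l kept(1)])
      next
        case new
        then have "pushed S (Suc k) q l = None" using pushed_eq[OF l, of q] q by simp
        moreover have "V' q (l - 1) = e q"
        proof (cases "l = m q")
          case True
          have "l - 1 < m q" using l True by simp
          then show ?thesis using e_V0[OF q] True by (simp only: V'_def if_True)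
        next
          case False
          then have "\<not> l - 1 < m q" "l - 1 < m (q - 1)" using new by auto
          then show ?thesis by (simp only: V'_def if_True if_False)
        qed
        ultimately show ?thesis using new by simp
      next
        case moved
        then have p: "pushed S (Suc k) q l = pushed S k (q - 1) l" using pushed_eq[OF l, of q] q by simp
        show ?thesis
        proof (cases "m (q - 1) = l")
          case True
          \<comment> \<open>At the first moved column the left neighbour is no longer the old one,
            so an empty box would be filled with the wrong value; the box at a cut is
            nonempty.\<close>
          then have "pushed S k (q - 1) l \<noteq> None"
            using cut_nonempty[OF reads cuts moved(4)] l by simp
          then obtain y where "pushed S k (q - 1) l = Some y" by blast
          then show ?thesis using old(2)[OF moved(4), of l] p moved by simp
        next
          case False
          have "m q \<le> m (q - 1)" using q by (intro m_antimono) auto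
          then have "\<not> l - 1 < m q" "\<not> l - 1 < m (q - 1)" using moved False by auto
          moreover have "q - 1 \<noteq> Suc k" using moved(4) by auto
          ultimately have V'_pred: "V' q (l - 1) = V (q - 1) (l - 1)"
            by (simp only: V'_def V0_def if_False)
          show ?thesis unfolding p V'_pred moved(3) by (rule old(2)[OF moved(4)])
        qed
      qed
    qed
  qed
qed

lemma filled_Suc: "filled n S (Suc k) V'"
proof
  show "1 \<le> Suc k" by simp
  show "Suc k \<le> p" by (rule Suc_k)
  show "\<exists>d. coloured S (Suc k) q l = Some (V' q l, d)" if q: "q \<in> {1..Suc k}" and l: "l \<in> {1..c}" for q l
    using q l
  proof (cases rule: V'_cases)
    case kept
    then show ?thesis using coloured_eq[OF l, of q] coloured_kept[OF q l] q by simp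
  next
    case new
    then show ?thesis using coloured_eq[OF l, of q] q by simp
  next
    case moved
    then show ?thesis using coloured_eq[OF l, of q] coloured_V[OF moved(4) l] q by simp
  qed
  show none: "pushed S (Suc k) q l = None" if "l \<notin> {1..c}" for q l
    unfolding pushed_Suc using outside(1)[OF that] by (rule fold_shift_down_None)
  show cnone: "coloured S (Suc k) q l = None" if "l \<notin> {1..c}" for q l
    unfolding coloured_Suc fill_def using that outside(2)[OF that] by (auto intro!: fold_shift_down_None)
  show "pushed S (Suc k) 0 l = None" for l
    using reads_Suc unfolding reads_def by blast
  show "coloured S (Suc k) 0 l = None" for l
    using cnone[of l 0] coloured_eq[of l 0] row_0(2) by (cases "l \<in> {1..c}") auto
  show "pushed S (Suc k) q l = tableau_config S q l" if "Suc k < q" for q l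
    using none[of l q] pushed_eq[of l q] below(1)[of q l] tableau_config_outside[of l q] that
    by (cases "l \<in> {1..c}") auto
  show "coloured S (Suc k) q l = row_coloured (tableau_config S) q l" if "Suc k < q" for q l
    using cnone[of l q] coloured_eq[of l q] below(2)[of q l] tableau_config_outside[of l q] that
    by (cases "l \<in> {1..c}") (auto simp: row_coloured_def)
  show "reads c (Suc k) (pushed S (Suc k)) V'" by (rule reads_Suc)
  show "V' q l \<le> V' q l'" if q: "q \<in> {1..Suc k}" and l: "1 \<le> l" "l \<le> l'" "l' \<le> c" for q l l'
    using l(2,3)
  proof (induction l' rule: dec_induct)
    case (step x)
    then have "V' q x \<le> V' q (Suc x)" using l(1) by (intro rows'[OF q]) auto
    then show ?case using step by simp
  qed simp
  show "V' q l < V' (Suc q) l" if "1 \<le> q" "q < Suc k" "l \<in> {1..c}" for q l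
    using that by (rule cols')
  show "V' q l = entry q l" if q: "q \<in> {1..Suc k}" and l: "l \<in> {1..row_length (Suc k)}" for q l
  proof -
    have "m (Suc k) \<le> m q" using q by (intro m_antimono) auto
    then have "V' q l = V0 q l" using l m_Suc_k by (simp add: V'_def)
    then show ?thesis using V_entry[of q l] q l row_length_Suc_k(3) by (cases "q = Suc k") (auto simp: V0_def)
  qed
  have pos: "1 \<le> V q l" if "q \<in> {1..k}" "l \<in> {1..c}" for q l
    using that by (rule V_pos)
  have V0_pos: "1 \<le> V0 q l" if q: "q \<in> {1..Suc k}" and l: "l \<in> {1..c}" "l < m q" for q l
  proof (cases "q = Suc k")
    case True
    then show ?thesis using entry_range[of "Suc k" l] Suc_k l m_Suc_k by (simp add: V0_def)
  next
    case False
    then show ?thesis using pos[of q l] q l by (simp add: V0_def)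
  qed
  show "1 \<le> V' q l" if q: "q \<in> {1..Suc k}" and l: "l \<in> {1..c}" for q l
    using q l
  proof (cases rule: V'_cases)
    case kept
    then show ?thesis using V0_pos[OF q l] by simp
  next
    case new
    have "m q - 1 \<in> {1..c}" "m q - 1 < m q" using q m_bounds(1,2)[of q] by auto
    then show ?thesis using V0_pos[OF q, of "m q - 1"] e_V0[OF q] new by simp
  next
    case moved
    then show ?thesis using pos[OF moved(4) l] by simp
  qed
  show "\<exists>q \<in> {1..Suc k}. coloured S (Suc k) q l = Some (chain l d, d)"
    if l: "l \<in> {1..c}" and d: "d \<in> {1..Suc k}" for l d
  proof (cases "d = Suc k")
    case False
    then obtain q where q: "q \<in> {1..k}" "coloured S k q l = Some (chain l d, d)"
      using colours[OF l, of d] d by auto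
    \<comment> \<open>An older colour moves down one row with its box or stays where it is.\<close>
    show ?thesis
    proof (cases "m q \<le> l")
      case True
      then have "coloured S (Suc k) (Suc q) l = Some (chain l d, d)"
        using coloured_eq[OF l, of "Suc q"] q by simp
      then show ?thesis using q by (intro bexI[of _ "Suc q"]) auto
    next
      case False
      have "m q \<le> m (q - 1)" using q by (intro m_antimono) auto
      then have "coloured S (Suc k) q l = Some (chain l d, d)"
        using coloured_eq[OF l, of q] q False by simp
      then show ?thesis using q by (intro bexI[of _ q]) auto
    qed
  next
    case d: True
    \<comment> \<open>Colour \<open>Suc k\<close> belongs to original entries up to the end of row
      \<open>Suc k\<close> of \<open>S\<close> and to filled copies beyond it.\<close>
    show ?thesis
    proof (cases "l \<le> row_length (Suc k)")
      case True
      then have "l < m (Suc k)" "l < m k" using m_Suc_k m_antimono[of k "Suc k"] by auto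
      then have "coloured S (Suc k) (Suc k) l = Some (entry (Suc k) l, Suc k)"
        using coloured_eq[OF l, of "Suc k"] below(2)[of "Suc k" l] Suc_k l True by (simp add: row_coloured_eq)
      moreover have "chain l (Suc k) = entry (Suc k) l" using Suc_k l True by (intro chain_entry) auto
      ultimately show ?thesis unfolding d by (intro bexI[of _ "Suc k"]) simp_all
    next
      case False
      obtain q where q: "q \<in> {1..Suc k}" "m q \<le> l" "l < m (q - 1)"
        using new_row_exists[of l] False l by auto
      then have "chain l (Suc k) = e q" using new_entry[of l q] False l by simp
      moreover have "coloured S (Suc k) q l = Some (e q, Suc k)" using coloured_eq[OF l, of q] q by simp
      ultimately show ?thesis unfolding d using q by auto
    qed
  qed
qed

end

section \<open>Induction over the steps\<close>

context semistandard
begin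

text \<open>Row 1 has full length \<open>c\<close>, so it is a filled rectangle from the
  start.\<close>

lemma filled_1: "filled n S 1 entry"
proof
  show "1 \<le> p" by (rule p_pos)
  show "\<exists>d. coloured S 1 q l = Some (entry q l, d)" if "q \<in> {1..1}" "l \<in> {1..c}" for q l
    using that p_pos row_length_1 by (simp add: row_coloured_eq)
  show "pushed S 1 q l = None" "coloured S 1 q l = None" if "l \<notin> {1..c}" for q l
    using tableau_config_outside[OF that] by (simp_all add: row_coloured_def)
  show "reads c 1 (pushed S 1) entry"
    unfolding reads_def using p_pos row_length_1 c_pos by (auto simp: tableau_config_eq)
  show "entry q l \<le> entry q l'" if "q \<in> {1..1}" "1 \<le> l" "l \<le> l'" "l' \<le> c" for q l l'
    using that p_pos row_length_1 by (intro entry_row_mono) auto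
  show "1 \<le> entry q l" if "q \<in> {1..1}" "l \<in> {1..c}" for q l
    using entry_range[of q l] that p_pos row_length_1 by auto
  show "\<exists>q \<in> {1..1}. coloured S 1 q l = Some (chain l d, d)" if "l \<in> {1..c}" "d \<in> {1..1}" for l d
    using that p_pos row_length_1 chain_entry[of 1 l] by (simp add: row_coloured_eq)
qed (auto simp: tableau_config_eq row_coloured_eq)

lemma filled_exists: "1 \<le> k \<Longrightarrow> k \<le> p \<Longrightarrow> \<exists>V. filled n S k V"
proof (induction k rule: dec_induct)
  case base
  show ?case using filled_1 by blast
next
  case (step k)
  then obtain V where "filled n S k V" by auto
  then interpret filled n S k V .
  let ?r = "row_length (Suc k)"
  have r: "1 \<le> ?r" "?r \<le> c" "?r \<le> row_length k"
    using row_length_pos[of "Suc k"] row_length_le[of "Suc k"] row_length_antimono[of k "Suc k"] step k by auto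
  \<comment> \<open>Up to the end of row \<open>Suc k\<close> the array still agrees with
    \<open>S\<close>, whose strict columns give the start condition for the cuts.\<close>
  have "V k ?r < entry (Suc k) ?r"
    using V_entry[of k ?r] entry_col_mono[of k "Suc k" ?r] r step k by simp
  then have "\<exists>m e. cuts c k V m e \<and> m (Suc k) = ?r + 1 \<and> e (Suc k) = entry (Suc k) ?r"
    using r by (intro cuts_exist rows cols) auto
  then obtain m e where "cuts c k V m e" "m (Suc k) = ?r + 1" "e (Suc k) = entry (Suc k) ?r" by blast
  then interpret push_step n S k V m e
    using step by unfold_locales auto
  show ?case using filled_Suc by blast
qed

text \<open>The bijection between colours and rows makes the entry of colour \<open>j\<close> in a
  column well defined, because rows outside \<open>{1..p}\<close> are empty.\<close>

lemma coloured_final: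
  assumes i: "i \<in> {1..c}" and j: "j \<in> {1..p}"
  shows "\<exists>!r. \<exists>v. coloured S p r i = Some (v, j)"
    and "\<exists>r. coloured S p r i = Some (chain i j, j)"
proof -
  obtain V where "filled n S p V" using filled_exists[of p] p_pos by auto
  then interpret filled n S p V .
  obtain R where R: "bij_betw R {1..p} {1..p}"
    "\<And>d. d \<in> {1..p} \<Longrightarrow> coloured S p (R d) i = Some (chain i d, d)"
    using colour_rows[OF i] by metis
  show "\<exists>r. coloured S p r i = Some (chain i j, j)" using R(2)[OF j] by blast
  show "\<exists>!r. \<exists>v. coloured S p r i = Some (v, j)"
  proof (rule ex1I[of _ "R j"])
    show "\<exists>v. coloured S p (R j) i = Some (v, j)" using R(2)[OF j] by blast
    fix r assume "\<exists>v. coloured S p r i = Some (v, j)"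
    then obtain v where v: "coloured S p r i = Some (v, j)" by blast
    have "r \<in> {1..p}"
    proof (rule ccontr)
      assume "r \<notin> {1..p}"
      then have "r = 0 \<or> p < r" by auto
      then have "coloured S p r i = None" using row_0(2) below(2)[of r i] by (auto simp: row_coloured_eq)
      then show False using v by simp
    qed
    then obtain d where d: "d \<in> {1..p}" "r = R d" using bij_betw_imp_surj_on[OF R(1)] by blast
    then have "d = j" using R(2)[of d] v by simp
    then show "r = R j" using d by simp
  qed
qed

end

theorem theorem3p3:
  fixes n p c :: nat and S :: tableau
  assumes "ssyt n S" and "p = num_rows S" and "c = num_cols S"
  shows "\<forall>i \<in> {1..c}.
    (\<forall>k \<in> {1..p}.
       (\<exists>!r. \<exists>v. coloured S p r i = Some (v, k)) \<and>
       (\<exists>r. coloured S p r i = Some (min_chain n S i k, k))) \<and>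
    map (min_chain n S i) [p + 1..<n + 1] =
      sorted_list_of_set ({1..n} - min_chain n S i ` {1..p})"
proof (cases "S = []")
  case True
  then show ?thesis using assms(3) by (simp add: num_cols_def)
next
  case False
  then interpret semistandard n S using assms(1) by unfold_locales
  have pc: "p = semistandard.p S" "c = semistandard.c S"
    using assms(2,3) by (simp_all add: p_def c_def num_rows_def)
  show ?thesis
  proof (intro ballI conjI)
    fix i k assume "i \<in> {1..c}" "k \<in> {1..p}"
    then show "\<exists>!r. \<exists>v. coloured S p r i = Some (v, k)"
      "\<exists>r. coloured S p r i = Some (min_chain n S i k, k)"
      unfolding pc by (rule coloured_final)+
  next
    fix i assume "i \<in> {1..c}"
    then have "1 \<le> i" by simp
    then show "map (min_chain n S i) [p + 1..<n + 1] = sorted_list_of_set ({1..n} - min_chain n S i ` {1..p})"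
      unfolding pc using chain_first(3) chain_tail by (intro tail_sorted chain_permutes) auto
  qed
qed

end
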